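(* Let $A=\mathbb{C}[\partial]e$ be the associative conformal algebra, free of rank 1 as a $\mathbb{C}[\partial]$-module, with $e_\lambda e=0$, and let $Q=\mathbb{C}[\partial]x$ be free of rank 1. Then $\mathcal{AH}_A^2(Q,A)$ is described by the following five kinds of flag datums $(h_\lambda(\cdot,\partial),D_\lambda,g_\lambda(\cdot,\partial),T_\lambda,Q_0(\lambda,\partial),P(\lambda,\partial))$ of $A$; that is, each of the following is a flag datum of $A$ and every flag datum of $A$ is equivalent ($\equiv$) to one of them: (1) $(0,0,0,0,Q(\lambda,\partial)e,0)$, where $Q(\lambda,\partial)\in\mathbb{C}[\lambda,\partial]$. Moreover, $(0,0,0,0,Q(\lambda,\partial)e,0)$ is equivalent to $(0,0,0,0,Q'(\lambda,\partial)e,0)$ if and only if there exists $\beta\in\mathbb{C}\setminus\{0\}$ such that $Q(\lambda,\partial)=\beta Q'(\lambda,\partial)$; (2) $(0,0,0,0,0,1)$; (3) $(0,0,0,T_\lambda^1,0,1)$, where $T_\lambda^1(e)=e$; (4) $(0,D_\lambda^1,0,0,0,1)$, where $D_\lambda^1(e)=e$; (5) $(0,D_\lambda^1,0,T_\lambda^1,0,1)$, where $D_\lambda^1(e)=T_\lambda^1(e)=e$.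
   Context: An associative conformal algebra is a $\mathbb{C}[\partial]$-module $A$ with a $\mathbb{C}$-bilinear $\lambda$-product $A\times A\to A[\lambda]$, $(a,b)\mapsto a_\lambda b$, such that $(\partial a)_\lambda b=-\lambda a_\lambda b$, $a_\lambda\partial b=(\lambda+\partial)a_\lambda b$ and $a_\lambda(b_\mu c)=(a_\lambda b)_{\lambda+\mu}c$. All maps are extended coefficientwise to polynomials in $\lambda,\mu$. For $\mathbb{C}[\partial]$-modules $U,V$, a left conformal linear map is a $\mathbb{C}$-linear map $a_\lambda:U\to V[\lambda]$ with $a_\lambda(\partial u)=-\lambda a_\lambda u$; a (right) conformal linear map is one with $a_\lambda(\partial u)=(\partial+\lambda)a_\lambda u$. (Here $\mathbb{C}[\lambda,\partial]=(\mathbb{C}[\partial])[\lambda]$.) Such maps on $\mathbb{C}[\partial]e$ are determined by their value at $e$. A flag datum of a free $A=\mathbb{C}[\partial]V$ (here $V=\mathbb{C}e$) is a 6-tuple $(h_\lambda(\cdot,\partial),D_\lambda,g_\lambda(\cdot,\partial),T_\lambda,Q_0(\lambda,\partial),P(\lambda,\partial))$ where $P(\lambda,\partial)\in\mathbb{C}[\lambda,\partial]$, $Q_0(\lambda,\partial)\in A[\lambda]$, $h_\lambda(\cdot,\partial):A\to\mathbb{C}[\lambda,\partial]$ and $D_\lambda:A\to A[\lambda]$ are left conformal linear maps, $g_\lambda(\cdot,\partial):A\to\mathbb{C}[\lambda,\partial]$ and $T_\lambda:A\to A[\lambda]$ are conformal linear maps, such that for all $a,b\in V$: 1. $D_{\lambda+\mu}(a_\lambda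 b)=a_\lambda(D_\mu(b))+h_\mu(b,\lambda+\partial)D_\lambda(a)$ 2. $h_\mu(b,\lambda+\partial)h_\lambda(a,\partial)=h_{\lambda+\mu}(a_\lambda b,\partial)$ 3. $a_\lambda(T_\mu(b))+g_\mu(b,\lambda+\partial)D_\lambda(a)=(D_\lambda(a))_{\lambda+\mu}b+h_\lambda(a,-\lambda-\mu)T_{\lambda+\mu}(b)$ 4. $g_\mu(b,\lambda+\partial)h_\lambda(a,\partial)=h_\lambda(a,-\lambda-\mu)g_{\lambda+\mu}(b,\partial)$ 5. $T_\lambda(a_\mu b)=(T_\lambda(a))_{\lambda+\mu}b+g_\lambda(a,-\lambda-\mu)T_{\lambda+\mu}(b)$ 6. $g_\lambda(a_\mu b,\partial)=g_\lambda(a,-\lambda-\mu)g_{\lambda+\mu}(b,\partial)$ 7. $P(\mu,\lambda+\partial)D_\lambda(a)=D_{\lambda+\mu}(D_\lambda(a))+h_\lambda(a,-\lambda-\mu)Q_0(\lambda+\mu,\partial)-a_\lambda(Q_0(\mu,\partial))$ 8. $P(\mu,\lambda+\partial)h_\lambda(a,\partial)=h_\lambda(a,-\lambda-\mu)P(\lambda+\mu,\partial)+h_{\lambda+\mu}(D_\lambda(a),\partial)$ 9. $T_\lambda(D_\mu(a))+h_\mu(a,\lambda+\partial)Q_0(\lambda,\partial)=D_{\lambda+\mu}(T_\lambda(a))+g_\lambda(a,-\lambda-\mu)Q_0(\lambda+\mu,\partial)$ 10. $g_\lambda(D_\mu(a),\partial)+h_\mu(a,\lambda+\partial)P(\lambda,\partial)=h_{\lambda+\mu}(T_\lambda(a),\partial)+g_\lambda(a,-\lambda-\mu)P(\lambda+\mu,\partial)$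 11. $T_\lambda(T_\mu(a))+g_\mu(a,\lambda+\partial)Q_0(\lambda,\partial)=Q_0(\lambda,\partial)_{\lambda+\mu}a+P(\lambda,-\lambda-\mu)T_{\lambda+\mu}(a)$ 12. $g_\lambda(T_\mu(a),\partial)+g_\mu(a,\lambda+\partial)P(\lambda,\partial)=P(\lambda,-\lambda-\mu)g_{\lambda+\mu}(a,\partial)$ 13. $T_\lambda(Q_0(\mu,\partial))+P(\mu,\lambda+\partial)Q_0(\lambda,\partial)=D_{\lambda+\mu}(Q_0(\lambda,\partial))+P(\lambda,-\lambda-\mu)Q_0(\lambda+\mu,\partial)$ 14. $g_\lambda(Q_0(\mu,\partial),\partial)+P(\mu,\lambda+\partial)P(\lambda,\partial)=h_{\lambda+\mu}(Q_0(\lambda,\partial),\partial)+P(\lambda,-\lambda-\mu)P(\lambda+\mu,\partial)$ Two flag datums (unprimed and primed) are equivalent ($\equiv$) if $h_\lambda(\cdot,\partial)=h'_\lambda(\cdot,\partial)$, $g_\lambda(\cdot,\partial)=g'_\lambda(\cdot,\partial)$ and there exist $T_0\in A$, $\beta\in\mathbb{C}\setminus\{0\}$ such that for all $a\in A$: $D_\lambda(a)=a_\lambda T_0+\beta D'_\lambda(a)-h_\lambda(a,\partial)T_0$; $T_\lambda(a)={T_0}_\lambda a+\beta T'_\lambda(a)-g_\lambda(a,\partial)T_0$; $P(\lambda,\partial)=h'_\lambda(T_0,\partial)+g'_\lambda(T_0,\partial)+\beta P'(\lambda,\partial)$; $Q_0(\lambda,\partial)={T_0}_\lambda T_0+\beta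 D'_\lambda(T_0)+\beta T'_\lambda(T_0)+\beta^2Q'_0(\lambda,\partial)-P(\lambda,\partial)T_0$. The set $\mathcal{AH}_A^2(Q,A)$, which classifies up to isomorphism restricting to the identity on $A$ the associative conformal algebra structures on the $\mathbb{C}[\partial]$-module $A\oplus\mathbb{C}[\partial]x$ containing $A$ as a subalgebra, is identified here with the set of flag datums of $A$ modulo $\equiv$. A flag datum corresponds to the structure with $x_\lambda x=Q_0(\lambda,\partial)+P(\lambda,\partial)x$, $a_\lambda x=D_\lambda(a)+h_\lambda(a,\partial)x$, $x_\lambda a=T_\lambda(a)+g_\lambda(a,\partial)x$ for $a\in V$. *)

theory Defs
  imports Complex_Main "HOL-Computational_Algebra.Polynomial"
begin

text \<open>
  A \<open>\<complex>[\<partial>]\<close>-module \<open>M\<close> is given by a scalar multiplication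
  \<open>s :: complex poly \<Rightarrow> 'm \<Rightarrow> 'm\<close> (\<^locale>\<open>module\<close>), where \<open>\<partial>\<close> is the polynomial variable.
  Formal polynomials with coefficients in \<open>M\<close>:
  \<^item> \<open>M[\<lambda>]\<close> is \<open>'m poly\<close>, where \<^term>\<open>pCons 0\<close> is multiplication by \<open>\<lambda>\<close>;
  \<^item> \<open>M[\<lambda>,\<mu>]\<close> is \<open>'m poly poly\<close>, with \<open>\<lambda>\<close> the inner and \<open>\<mu>\<close> the outer variable;
  \<^item> \<open>\<complex>[\<lambda>,\<partial>] = (\<complex>[\<partial>])[\<lambda>]\<close> is \<open>complex poly poly\<close>, i.e. \<open>M[\<lambda>]\<close> for \<open>M = \<complex>[\<partial>]\<close> with \<open>s = (*)\<close>.
\<close>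

definition del :: "(complex poly \<Rightarrow> 'm \<Rightarrow> 'm) \<Rightarrow> 'm \<Rightarrow> 'm" where
  "del s u = s [:0, 1:] u"


section \<open>Conformal linear maps\<close>

definition complex_linear ::
  "(complex poly \<Rightarrow> 'u::ab_group_add \<Rightarrow> 'u) \<Rightarrow> (complex poly \<Rightarrow> 'v::ab_group_add \<Rightarrow> 'v)
    \<Rightarrow> ('u \<Rightarrow> 'v poly) \<Rightarrow> bool" where
  "complex_linear s t \<phi> \<longleftrightarrow>
     (\<forall>u w. \<phi> (u + w) = \<phi> u + \<phi> w) \<and>
     (\<forall>c u. \<phi> (s [:c:] u) = map_poly (t [:c:]) (\<phi> u))"

definition left_conformal ::
  "(complex poly \<Rightarrow> 'u::ab_group_add \<Rightarrow> 'u) \<Rightarrow> (complex poly \<Rightarrow> 'v::ab_group_add \<Rightarrow> 'v)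
    \<Rightarrow> ('u \<Rightarrow> 'v poly) \<Rightarrow> bool" where
  "left_conformal s t \<phi> \<longleftrightarrow>
     complex_linear s t \<phi> \<and> (\<forall>u. \<phi> (del s u) = - pCons 0 (\<phi> u))"

definition right_conformal ::
  "(complex poly \<Rightarrow> 'u::ab_group_add \<Rightarrow> 'u) \<Rightarrow> (complex poly \<Rightarrow> 'v::ab_group_add \<Rightarrow> 'v)
    \<Rightarrow> ('u \<Rightarrow> 'v poly) \<Rightarrow> bool" where
  "right_conformal s t \<phi> \<longleftrightarrow>
     complex_linear s t \<phi> \<and> (\<forall>u. \<phi> (del s u) = map_poly (del t) (\<phi> u) + pCons 0 (\<phi> u))"


section \<open>Calculus in two variables\<close>

text \<open>Multiplication operators on \<open>M[\<lambda>,\<mu>]\<close>: by \<open>\<lambda>\<close>, \<open>\<mu>\<close>, \<open>\<partial>\<close>, \<open>\<lambda>+\<mu>\<close>, \<open>\<lambda>+\<partial>\<close> and \<open>-\<lambda>-\<mu>\<close>.\<close>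

definition lam :: "'m::ab_group_add poly poly \<Rightarrow> 'm poly poly" where
  "lam = map_poly (pCons 0)"

definition mu :: "'m::ab_group_add poly poly \<Rightarrow> 'm poly poly" where
  "mu = pCons 0"

definition del2 :: "(complex poly \<Rightarrow> 'm::ab_group_add \<Rightarrow> 'm) \<Rightarrow> 'm poly poly \<Rightarrow> 'm poly poly" where
  "del2 s = map_poly (map_poly (del s))"

definition lam_mu :: "'m::ab_group_add poly poly \<Rightarrow> 'm poly poly" where
  "lam_mu x = lam x + mu x"

definition lam_del :: "(complex poly \<Rightarrow> 'm::ab_group_add \<Rightarrow> 'm) \<Rightarrow> 'm poly poly \<Rightarrow> 'm poly poly" where
  "lam_del s x = lam x + del2 s x"

definition neg_lam_mu :: "'m::ab_group_add poly poly \<Rightarrow> 'm poly poly" where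
  "neg_lam_mu x = - lam x - mu x"

text \<open>\<open>subs S p\<close> is \<open>p(\<lambda>) \<in> M[\<lambda>]\<close> with \<open>\<lambda>\<close> replaced by the operator \<open>S\<close>; for example
  \<open>subs lam_mu p\<close> is \<open>p(\<lambda>+\<mu>) \<in> M[\<lambda>,\<mu>]\<close>.\<close>

definition subs :: "('m::ab_group_add poly poly \<Rightarrow> 'm poly poly) \<Rightarrow> 'm poly \<Rightarrow> 'm poly poly" where
  "subs S p = (\<Sum>n\<le>degree p. (S ^^ n) [:[:coeff p n:]:])"

text \<open>\<open>ext \<phi> S\<close> is the coefficientwise extension to \<open>U[\<lambda>,\<mu>] \<rightarrow> V[\<lambda>,\<mu>]\<close> of the map \<open>\<phi>\<^sub>S : U \<rightarrow> V[\<lambda>,\<mu>]\<close>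
  obtained from \<open>\<phi>\<^sub>\<lambda> : U \<rightarrow> V[\<lambda>]\<close> by replacing \<open>\<lambda>\<close> by \<open>S\<close>.\<close>

definition ext ::
  "('u::ab_group_add \<Rightarrow> 'v::ab_group_add poly) \<Rightarrow> ('v poly poly \<Rightarrow> 'v poly poly)
    \<Rightarrow> 'u poly poly \<Rightarrow> 'v poly poly" where
  "ext \<phi> S x =
     (\<Sum>j\<le>degree x. \<Sum>i\<le>degree (coeff x j).
        (mu ^^ j) ((lam ^^ i) (subs S (\<phi> (coeff (coeff x j) i)))))"

text \<open>\<open>act s p U W x\<close> is the product of \<open>p(U, W)\<close> with \<open>x \<in> M[\<lambda>,\<mu>]\<close>, where \<open>p(\<lambda>,\<partial>) \<in> \<complex>[\<lambda>,\<partial>]\<close> and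
  \<open>\<lambda>\<close>, \<open>\<partial>\<close> are replaced by the (commuting) multiplication operators \<open>U\<close>, \<open>W\<close>; for example
  \<open>act s p mu (lam_del s) x\<close> is \<open>p(\<mu>, \<lambda>+\<partial>) x\<close>.\<close>

definition act ::
  "(complex poly \<Rightarrow> 'm::ab_group_add \<Rightarrow> 'm) \<Rightarrow> complex poly poly
    \<Rightarrow> ('m poly poly \<Rightarrow> 'm poly poly) \<Rightarrow> ('m poly poly \<Rightarrow> 'm poly poly)
    \<Rightarrow> 'm poly poly \<Rightarrow> 'm poly poly" where
  "act s p U W x =
     (\<Sum>i\<le>degree p. \<Sum>j\<le>degree (coeff p i).
        map_poly (map_poly (s [:coeff (coeff p i) j:])) ((U ^^ i) ((W ^^ j) x)))"


section \<open>Associative conformal algebras and flag datums\<close>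

type_synonym 'a flag =
  "('a \<Rightarrow> complex poly poly) \<times> ('a \<Rightarrow> 'a poly) \<times> ('a \<Rightarrow> complex poly poly) \<times> ('a \<Rightarrow> 'a poly)
    \<times> 'a poly \<times> complex poly poly"

text \<open>\<open>lp a b\<close> is \<open>a\<^sub>\<lambda> b\<close>. The first two axioms comprise \<open>\<complex>\<close>-bilinearity.\<close>

locale assoc_conformal_algebra = module dm
  for dm :: "complex poly \<Rightarrow> 'a::ab_group_add \<Rightarrow> 'a" +
  fixes lp :: "'a \<Rightarrow> 'a \<Rightarrow> 'a poly"
  assumes left_conformal_lp: "left_conformal dm dm (\<lambda>a. lp a b)"
    and right_conformal_lp: "right_conformal dm dm (lp a)"
    and lp_assoc: "ext (lp a) lam (subs mu (lp b c)) = ext (\<lambda>x. lp x c) lam_mu (subs lam (lp a b))"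
begin

text \<open>\<open>V\<close> is to be a complex subspace of \<open>A\<close> with \<open>A = \<complex>[\<partial>]V\<close> free over \<open>V\<close>.\<close>

definition flag_datum :: "'a set \<Rightarrow> 'a flag \<Rightarrow> bool" where
  "flag_datum V F = (case F of (h, D, g, T, Q, P) \<Rightarrow>
     left_conformal dm (*) h \<and> left_conformal dm dm D \<and>
     right_conformal dm (*) g \<and> right_conformal dm dm T \<and>
     (\<forall>a\<in>V. \<forall>b\<in>V.
       ext D lam_mu (subs lam (lp a b))
         = ext (lp a) lam (subs mu (D b)) + act dm (h b) mu (lam_del dm) (subs lam (D a)) \<and>
       act (*) (h b) mu (lam_del (*)) (subs lam (h a))
         = ext h lam_mu (subs lam (lp a b)) \<and>
       ext (lp a) lam (subs mu (T b)) + act dm (g b) mu (lam_del dm) (subs lam (D a))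
         = ext (\<lambda>x. lp x b) lam_mu (subs lam (D a)) + act dm (h a) lam neg_lam_mu (subs lam_mu (T b)) \<and>
       act (*) (g b) mu (lam_del (*)) (subs lam (h a))
         = act (*) (h a) lam neg_lam_mu (subs lam_mu (g b)) \<and>
       ext T lam (subs mu (lp a b))
         = ext (\<lambda>x. lp x b) lam_mu (subs lam (T a)) + act dm (g a) lam neg_lam_mu (subs lam_mu (T b)) \<and>
       ext g lam (subs mu (lp a b))
         = act (*) (g a) lam neg_lam_mu (subs lam_mu (g b))) \<and>
     (\<forall>a\<in>V.
       act dm P mu (lam_del dm) (subs lam (D a))
         = ext D lam_mu (subs lam (D a)) + act dm (h a) lam neg_lam_mu (subs lam_mu Q)
           - ext (lp a) lam (subs mu Q) \<and>
       act (*) P mu (lam_del (*)) (subs lam (h a))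
         = act (*) (h a) lam neg_lam_mu (subs lam_mu P) + ext h lam_mu (subs lam (D a)) \<and>
       ext T lam (subs mu (D a)) + act dm (h a) mu (lam_del dm) (subs lam Q)
         = ext D lam_mu (subs lam (T a)) + act dm (g a) lam neg_lam_mu (subs lam_mu Q) \<and>
       ext g lam (subs mu (D a)) + act (*) (h a) mu (lam_del (*)) (subs lam P)
         = ext h lam_mu (subs lam (T a)) + act (*) (g a) lam neg_lam_mu (subs lam_mu P) \<and>
       ext T lam (subs mu (T a)) + act dm (g a) mu (lam_del dm) (subs lam Q)
         = ext (\<lambda>x. lp x a) lam_mu (subs lam Q) + act dm P lam neg_lam_mu (subs lam_mu (T a)) \<and>
       ext g lam (subs mu (T a)) + act (*) (g a) mu (lam_del (*)) (subs lam P)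
         = act (*) P lam neg_lam_mu (subs lam_mu (g a))) \<and>
     ext T lam (subs mu Q) + act dm P mu (lam_del dm) (subs lam Q)
       = ext D lam_mu (subs lam Q) + act dm P lam neg_lam_mu (subs lam_mu Q) \<and>
     ext g lam (subs mu Q) + act (*) P mu (lam_del (*)) (subs lam P)
       = ext h lam_mu (subs lam Q) + act (*) P lam neg_lam_mu (subs lam_mu P))"

text \<open>\<open>pmul p u\<close> is \<open>p(\<lambda>,\<partial>) u \<in> A[\<lambda>]\<close> for \<open>u \<in> A\<close>.\<close>

definition pmul :: "complex poly poly \<Rightarrow> 'a \<Rightarrow> 'a poly" where
  "pmul p u = map_poly (\<lambda>f. dm f u) p"

definition cmul :: "complex \<Rightarrow> 'a poly \<Rightarrow> 'a poly" where
  "cmul c = map_poly (dm [:c:])"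

definition flag_equiv :: "'a flag \<Rightarrow> 'a flag \<Rightarrow> bool" where
  "flag_equiv F F' = (case F of (h, D, g, T, Q, P) \<Rightarrow> case F' of (h', D', g', T', Q', P') \<Rightarrow>
     h = h' \<and> g = g' \<and>
     (\<exists>T0 \<beta>. \<beta> \<noteq> 0 \<and>
       (\<forall>a. D a = lp a T0 + cmul \<beta> (D' a) - pmul (h a) T0) \<and>
       (\<forall>a. T a = lp T0 a + cmul \<beta> (T' a) - pmul (g a) T0) \<and>
       P = h' T0 + g' T0 + smult [:\<beta>:] P' \<and>
       Q = lp T0 T0 + cmul \<beta> (D' T0) + cmul \<beta> (T' T0) + cmul (\<beta>\<^sup>2) Q' - pmul P T0))"

definition flag_rel :: "'a set \<Rightarrow> ('a flag \<times> 'a flag) set" where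
  "flag_rel V = {(F, F'). flag_datum V F \<and> flag_datum V F' \<and> flag_equiv F F'}"

text \<open>\<open>\<A>\<H>\<^sup>2\<^sub>A(Q,A)\<close> for \<open>Q = \<complex>[\<partial>]x\<close> free of rank 1, in its identification with the flag datums
  of \<open>A\<close> modulo equivalence.\<close>

definition AH2 :: "'a set \<Rightarrow> 'a flag set set" where
  "AH2 V = {F. flag_datum V F} // flag_rel V"

end

end

theory Submission
  imports Defs "HOL-Analysis.Derivative"
begin

text \<open>
  Identifying \<open>A\<close> with \<open>\<complex>[\<partial>]\<close> and evaluating at complex values of \<open>\<lambda>\<close>, \<open>\<mu>\<close>, \<open>\<partial>\<close> turns the axioms of a flag
  datum into functional equations for polynomials in two variables. The \<open>\<lambda>\<close>-product vanishes, so
  (2) and (6) force \<open>h = g = 0\<close>. Comparing degrees, (14) forces \<open>P\<close> to be a constant \<open>c\<close>, and (7) and (11)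
  force \<open>D\<close> and \<open>T\<close> to be constants in \<open>{0,c}\<close>. If \<open>c = 0\<close>, only \<open>Q\<^sub>0\<close> is left. If \<open>c \<noteq> 0\<close>, take \<open>\<beta> = c\<close>;
  then (13) is a cocycle equation for \<open>Q\<^sub>0\<close> whose solutions are exactly the coboundaries removed
  by \<open>T\<^sub>0\<close>. In the hardest case \<open>D = T = c\<close> it is the 2-cocycle equation of the additive group, and
  differentiating it in the first argument at 0 exhibits the cochain.
\<close>

section \<open>Functional equations for bivariate polynomials\<close>

definition eval2 :: "complex poly poly \<Rightarrow> complex \<Rightarrow> complex \<Rightarrow> complex" where
  "eval2 F x y = poly (poly F [:x:]) y"

lemma eval2_0 [simp]: "eval2 0 x y = 0"
  and eval2_1 [simp]: "eval2 1 x y = 1"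
  and eval2_pCons [simp]: "eval2 (pCons q F) x y = poly q y + x * eval2 F x y"
  and eval2_add [simp]: "eval2 (F + G) x y = eval2 F x y + eval2 G x y"
  and eval2_minus [simp]: "eval2 (- F) x y = - eval2 F x y"
  and eval2_smult [simp]: "eval2 (smult q F) x y = poly q y * eval2 F x y"
  by (simp_all add: eval2_def)

text \<open>A nonzero polynomial over a domain has finitely many roots, but \<open>range g\<close>
  is infinite. Coefficients may thus themselves be polynomials, with \<open>g\<close> embedding only
  the constants.\<close>

lemma poly_ext_inj:
  fixes p q :: "'a::idom poly" and g :: "complex \<Rightarrow> 'a"
  assumes "inj g" "\<And>c. poly p (g c) = poly q (g c)"
  shows "p = q"
proof (rule ccontr)
  assume "p \<noteq> q"
  then have "finite {x. poly (p - q) x = 0}"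
    by (intro poly_roots_finite) simp
  moreover have "range g \<subseteq> {x. poly (p - q) x = 0}"
    using assms(2) by auto
  ultimately have "finite (range g)"
    by (rule rev_finite_subset)
  then show False
    using assms(1) by (simp add: finite_image_iff infinite_UNIV_char_0)
qed

lemma eval2_ext:
  assumes "\<And>x y. eval2 F x y = eval2 G x y"
  shows "F = G"
  using assms
  by (intro poly_ext_inj[of "\<lambda>c. [:c:]"] poly_ext) (simp_all add: eval2_def inj_def)

lemma eval2_fst: "eval2 F x y = poly (map_poly (\<lambda>q. poly q y) F) x"
  by (induction F) (simp_all add: map_poly_pCons)

section \<open>Product equations that force constancy\<close>

lemma degree_section_bounded: "\<exists>N. \<forall>x. degree (poly F [:x:]) \<le> N"
proof (induction F)
  case (pCons q F)
  then obtain N where N: "\<And>x. degree (poly F [:x:]) \<le> N" by blast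
  have "degree (poly (pCons q F) [:x:]) \<le> max (degree q) N" for x
  proof -
    have "degree (smult x (poly F [:x:])) \<le> N"
      using N degree_smult_le le_trans by blast
    then show ?thesis
      by (simp add: degree_add_le)
  qed
  then show ?case by blast
qed simp

text \<open>Let the section F(z,.) have maximal degree n. If it is nonzero, then for x = z the left
  side has degree 2n in y and the right side at most n, so n = 0. Letting \<open>K\<close> depend on
  \<open>x\<close> and \<open>z\<close> covers both a fixed constant and the factor
  F(x,-x-z).\<close>

lemma eval2_const_right:
  assumes "\<And>x z. \<exists>K. \<forall>y. eval2 F z (x + y) * eval2 F x y = K * eval2 F (x + z) y"
  shows "eval2 F x y = eval2 F x 0"
proof -
  obtain N where N: "\<And>x. degree (poly F [:x:]) \<le> N"
    using degree_section_bounded by blast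
  then obtain z where z: "\<And>x. degree (poly F [:x:]) \<le> degree (poly F [:z:])"
    using ex_has_greatest_nat[of "\<lambda>_. True" 0 "\<lambda>x. degree (poly F [:x:])" "Suc N"]
    by (auto simp: less_Suc_eq_le)
  define p where "p = poly F [:z:]"
  obtain K where K: "\<And>y. eval2 F z (z + y) * eval2 F z y = K * eval2 F (z + z) y"
    using assms by blast
  have eq: "pcompose p [:z, 1:] * p = smult K (poly F [:z + z:])"
    using K by (intro poly_ext) (simp add: poly_pcompose p_def eval2_def)
  have "degree p = 0"
  proof (cases "p = 0")
    case False
    then have "pcompose p [:z, 1:] \<noteq> 0"
      by (simp add: pcompose_eq_0_iff)
    with False have "degree (pcompose p [:z, 1:] * p) = degree p + degree p"
      by (simp add: degree_mult_eq degree_pcompose)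
    moreover have "degree (smult K (poly F [:z + z:])) \<le> degree p"
      unfolding p_def using degree_smult_le z le_trans by blast
    ultimately show ?thesis
      using eq by simp
  qed simp
  then have "degree (poly F [:x:]) = 0"
    using z[of x] by (simp add: p_def)
  then show ?thesis
    by (metis eval2_def degree_eq_zeroE poly_pCons mult_zero_right poly_0)
qed

text \<open>On the diagonal the equation reads p(x)^2 = c p(2x), and comparing degrees leaves only
  constants.\<close>

lemma multiplicative_poly_const:
  fixes p :: "'a::{idom,ring_char_0} poly"
  assumes "\<And>x y. poly p x * poly p y = c * poly p (x + y)"
  obtains b where "p = [:b:]" "b = 0 \<or> b = c"
proof -
  have eq: "p * p = smult c (pcompose p [:0, 2:])"
  proof (rule poly_ext)
    fix x show "poly (p * p) x = poly (smult c (pcompose p [:0, 2:])) x"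
      using assms[of x x] by (simp add: poly_pcompose flip: mult_2_right)
  qed
  have "degree p = 0"
  proof (cases "p = 0")
    case False
    then have "degree p + degree p \<le> degree (pcompose p [:0, 2:])"
      by (metis eq degree_mult_eq degree_smult_le)
    then show ?thesis by (simp add: degree_pcompose)
  qed simp
  then obtain b where b: "p = [:b:]"
    by (rule degree_eq_zeroE)
  with assms[of 0 0] have "b = 0 \<or> b = c" by simp
  with b that show thesis by blast
qed

text \<open>The equations for \<open>h\<close> (with c = 0) and for \<open>T\<close> have this
  shape. Once dependence on the second argument is excluded, it is multiplicativity up to the factor
  c.\<close>

lemma shift_product_const:
  assumes "\<And>x y z. eval2 F z (x + y) * eval2 F x y = c * eval2 F (x + z) y"
  shows "(\<forall>x y. eval2 F x y = 0) \<or> (\<forall>x y. eval2 F x y = c)"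
proof -
  have const: "eval2 F x y = eval2 F x 0" for x y
    by (rule eval2_const_right) (use assms in blast)
  define p where "p = map_poly (\<lambda>q. poly q 0) F"
  have p: "eval2 F x y = poly p x" for x y
    using const[of x y] by (simp add: p_def eval2_fst)
  have "poly p x * poly p y = c * poly p (x + y)" for x y
    using assms[of y x] unfolding p by (simp add: ac_simps)
  then obtain b where "p = [:b:]" "b = 0 \<or> b = c"
    by (rule multiplicative_poly_const)
  with p show ?thesis by auto
qed

lemma associative_product_const:
  assumes "\<And>x y z. eval2 F z (x + y) * eval2 F x y = eval2 F x (- x - z) * eval2 F (x + z) y"
  shows "\<exists>b. \<forall>x y. eval2 F x y = b"
proof -
  have const: "eval2 F x y = eval2 F x 0" for x y
    by (rule eval2_const_right) (use assms in blast)
  define p where "p = map_poly (\<lambda>q. poly q 0) F"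
  have p: "eval2 F x y = poly p x" for x y
    using const[of x y] by (simp add: p_def eval2_fst)
  \<comment> \<open>The instance z = 0 is p(0) p(x) = p(x)^2, and polynomials form an integral
    domain.\<close>
  have "p * (p - [:poly p 0:]) = 0"
  proof (rule poly_ext)
    fix x
    show "poly (p * (p - [:poly p 0:])) x = poly 0 x"
      using assms[of 0 x] unfolding p by auto
  qed
  then have "p = 0 \<or> p = [:poly p 0:]"
    by simp
  then obtain b where "p = [:b:]"
    by (metis pCons_0_0)
  with p show ?thesis by simp
qed

text \<open>For fixed x and y the left side is a product of two polynomials in z whose value is
  constant. If the product is nonzero, both factors have degree 0, so one nonzero value of F
  propagates along its row and then along every column. The equations for \<open>g\<close> (with c =
  0) and for \<open>D\<close> have this shape.\<close>

lemma middle_product_const: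
  assumes "\<And>x y z. eval2 F x (- z) * eval2 F z y = c * eval2 F x y"
  shows "(\<forall>x y. eval2 F x y = 0) \<or> (\<forall>x y. eval2 F x y = c)"
proof (cases "\<forall>x y. eval2 F x y = 0")
  case True
  then show ?thesis by blast
next
  case False
  then obtain x0 y0 where nz: "eval2 F x0 y0 \<noteq> 0" by blast
  define p where "p x = pcompose (poly F [:x:]) [:0, -1:]" for x
  define q where "q y = map_poly (\<lambda>q. poly q y) F" for y
  have p: "eval2 F x y = poly (p x) (- y)" and q: "eval2 F x y = poly (q y) x" for x y
    by (simp_all add: p_def q_def eval2_def poly_pcompose eval2_fst[symmetric])
  have eq: "p x * q y = [:c * eval2 F x y:]" for x y
  proof (rule poly_ext)
    fix z show "poly (p x * q y) z = poly [:c * eval2 F x y:] z"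
      using assms[of x z y] p[of x "- z"] q[of z y] by simp
  qed
  have "p x0 \<noteq> 0" "q y0 \<noteq> 0"
    using nz p q by fastforce+
  then have "degree (p x0 * q y0) = degree (p x0) + degree (q y0)"
    by (rule degree_mult_eq)
  then have "degree (p x0) = 0"
    by (simp add: eq)
  then obtain b where b: "p x0 = [:b:]"
    by (rule degree_eq_zeroE)
  then have x0: "eval2 F x0 y = b" for y
    by (simp add: p)
  have "q y = [:b:]" for y
  proof -
    have "b \<noteq> 0" using nz x0 by simp
    then have "q y \<noteq> 0"
      using x0[of y] q by fastforce
    then have "degree (p x0 * q y) = degree (p x0) + degree (q y)"
      using \<open>p x0 \<noteq> 0\<close> by (intro degree_mult_eq)
    then have "degree (q y) = 0"
      by (simp add: eq)
    then obtain b' where "q y = [:b':]"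
      by (rule degree_eq_zeroE)
    with q[of x0 y] x0 show ?thesis by simp
  qed
  then have "eval2 F x y = b" for x y
    by (simp add: q)
  moreover from this assms[of 0 0 0] have "b = 0 \<or> b = c"
    by simp
  ultimately show ?thesis by auto
qed

section \<open>Cocycle equations and their coboundaries\<close>

lemma eval2_has_field_derivative:
  assumes "(u has_field_derivative u') (at a)" "(v has_field_derivative v') (at a)"
  shows "((\<lambda>t. eval2 F (u t) (v t)) has_field_derivative
           u' * eval2 (pderiv F) (u a) (v a) + v' * eval2 (map_poly pderiv F) (u a) (v a)) (at a)"
proof (induction F)
  case (pCons q F)
  have "((\<lambda>t. poly q (v t)) has_field_derivative poly (pderiv q) (v a) * v') (at a)"
    by (rule DERIV_chain2[OF poly_DERIV assms(2)])
  from DERIV_add[OF this DERIV_mult[OF assms(1) pCons.IH]] show ?case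
    by (simp add: pderiv_pCons map_poly_pCons algebra_simps)
qed simp

lemma ex_antiderivative:
  fixes p :: "'a::field_char_0 poly"
  obtains q where "pderiv q = p" "poly q 0 = k"
proof
  let ?q = "pCons k (Poly (map (\<lambda>n. coeff p n / of_nat (Suc n)) [0..<Suc (degree p)]))"
  show "pderiv ?q = p"
    by (intro poly_eqI)
       (simp add: coeff_pderiv coeff_Poly_eq nth_default_def coeff_eq_0 del: of_nat_Suc upt_Suc)
  show "poly ?q 0 = k" by simp
qed

text \<open>Differentiating the cocycle equation in x at 0 expresses the x-derivative R1 of R
  through its values r at x = 0: R1(y,z) = r(y+z) - r(y). Integrating -r gives the cochain.\<close>

lemma group_cocycle_coboundary:
  fixes F :: "complex poly poly" and R :: "complex \<Rightarrow> complex \<Rightarrow> complex"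
  defines "R x y \<equiv> eval2 F (- x) (x + y)"
  assumes cocycle: "\<And>x y z. R y z + R x (y + z) = R x y + R (x + y) z"
  obtains p where "\<And>x y. R x y = poly p x + poly p y - poly p (x + y)"
proof -
  \<comment> \<open>\<open>map_poly pderiv F\<close> and \<open>pderiv F\<close> are the partial
    derivatives in the second and first argument; the chain rule along (-x, x+y) gives the
    signs.\<close>
  define R1 where "R1 x y = eval2 (map_poly pderiv F) (- x) (x + y) - eval2 (pderiv F) (- x) (x + y)" for x y
  have deriv: "((\<lambda>x. R x y) has_field_derivative R1 x y) (at x)" for x y
    unfolding R_def R1_def
    by (rule DERIV_cong[OF eval2_has_field_derivative[OF DERIV_minus[OF DERIV_ident]
            DERIV_add[OF DERIV_ident DERIV_const[of y]]]]) simp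
  define r where "r = poly (map_poly pderiv F - pderiv F) 0"
  have r: "R1 0 y = poly r y" for y
    by (simp add: R1_def r_def eval2_def)
  have R1: "R1 y z = poly r (y + z) - poly r y" for y z
  proof -
    have "((\<lambda>x. R y z + R x (y + z)) has_field_derivative 0 + R1 0 (y + z)) (at 0)"
      by (rule DERIV_add[OF DERIV_const deriv])
    moreover have "((\<lambda>x. R x y + R (x + y) z) has_field_derivative R1 0 y + R1 (0 + y) z * (1 + 0)) (at 0)"
      by (rule DERIV_add[OF deriv DERIV_chain2[OF deriv DERIV_add[OF DERIV_ident DERIV_const]]])
    ultimately have "0 + R1 0 (y + z) = R1 0 y + R1 (0 + y) z * (1 + 0)"
      unfolding cocycle by (rule DERIV_unique)
    then show ?thesis
      by (simp add: r)
  qed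
  \<comment> \<open>Since R(0,y) = R(0,0), this value at 0 makes the integration constant equal to
    q(y).\<close>
  obtain q where q: "pderiv q = - r" "poly q 0 = R 0 0"
    by (rule ex_antiderivative)
  have "R x y = poly q x + poly q y - poly q (x + y)" for x y
  proof -
    have "((\<lambda>x. R x y - poly q x + poly q (x + y)) has_field_derivative
            R1 x y - poly (pderiv q) x + poly (pderiv q) (x + y) * (1 + 0)) (at x)" for x
      by (intro DERIV_add DERIV_diff deriv poly_DERIV DERIV_chain2[OF poly_DERIV] DERIV_ident DERIV_const)
    then have "((\<lambda>x. R x y - poly q x + poly q (x + y)) has_field_derivative 0) (at x within UNIV)" for x
      by (simp add: q R1)
    from has_field_derivative_zero_constant[OF convex_UNIV this]
    obtain k where k: "\<And>x. R x y - poly q x + poly q (x + y) = k"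
      by auto
    have "R 0 y = R 0 0"
      using cocycle[of 0 y 0] by simp
    with k[of x] k[of 0] q(2) show ?thesis
      by (simp add: algebra_simps)
  qed
  then show thesis by (rule that)
qed

text \<open>If both parameters equal \<^term>\<open>c\<close>, the substitution \<open>R(x,y) = F(-x, x+y)\<close> turns the equation
  into the cocycle condition of the additive group.\<close>

lemma flag_cocycle_coboundary:
  assumes "c \<noteq> 0" and s: "s = 0 \<or> s = c" and t: "t = 0 \<or> t = c"
    and eq: "\<And>x y z. t * eval2 F z (x + y) + c * eval2 F x y
                = s * eval2 F x (- x - z) + c * eval2 F (x + z) y"
  obtains p where "\<And>x y. eval2 F x y = s * poly p (- x) + t * poly p (x + y) - c * poly p y"
proof -
  have "\<exists>p. \<forall>x y. eval2 F x y = s * poly p (- x) + t * poly p (x + y) - c * poly p y"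
  proof (cases "t = 0")
    case t: True
    \<comment> \<open>For t = 0 the desired formula at x = 0 reads F(0,y) = s p(0) - c p(y), which
      determines p up to a constant.\<close>
    define p where "p = smult (- 1 / c) (poly F 0)"
    have p: "c * poly p y = - eval2 F 0 y" for y
      using \<open>c \<noteq> 0\<close> by (simp add: p_def eval2_def)
    show ?thesis
    proof (cases "s = 0")
      case True
      have "eval2 F x y = eval2 F 0 y" for x y
        using eq[of "- x" x y] t True \<open>c \<noteq> 0\<close> by simp
      then show ?thesis
        using p t True by (intro exI[of _ p]) simp
    next
      case False
      with s have s: "s = c" by simp
      have eq': "eval2 F x y = eval2 F x (- x - z) + eval2 F (x + z) y" for x y z
        using eq[of z x y] t s \<open>c \<noteq> 0\<close> by (simp flip: distrib_left)
      have "eval2 F x 0 = - eval2 F 0 (- x)" for x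
      proof -
        have "eval2 F 0 0 = 0"
          using eq'[of 0 0 0] by simp
        then show ?thesis
          using eq'[of 0 0 x] by (simp add: eq_neg_iff_add_eq_0 add.commute)
      qed
      then have F: "eval2 F x y = eval2 F 0 y - eval2 F 0 (- x)" for x y
        using eq'[of x y "- x"] by simp
      have "eval2 F x y = s * poly p (- x) + t * poly p (x + y) - c * poly p y" for x y
        using F[of x y] p[of y] p[of "- x"] t s by simp
      then show ?thesis by blast
    qed
  next
    case False
    with t have t: "t = c" by simp
    show ?thesis
    proof (cases "s = 0")
      case True
      \<comment> \<open>With s = 0 and t = c the desired formula at y = 0 reads F(x,0) = c p(x) - c
        p(0), so this slice determines p up to a constant.\<close>
      define p where "p = smult (1 / c) (map_poly (\<lambda>q. poly q 0) F)"
      have p: "c * poly p y = eval2 F y 0" for y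
        using \<open>c \<noteq> 0\<close> by (simp add: p_def eval2_fst)
      have F: "eval2 F x y = eval2 F (x + y) 0 - eval2 F y 0" for x y
        using eq[of x y 0] t True \<open>c \<noteq> 0\<close> by (simp add: eq_diff_eq add.commute flip: distrib_left)
      have "eval2 F x y = s * poly p (- x) + t * poly p (x + y) - c * poly p y" for x y
        using F[of x y] p[of y] p[of "x + y"] t True by simp
      then show ?thesis by blast
    next
      case False
      with s have s: "s = c" by simp
      have eq': "eval2 F z (x + y) + eval2 F x y = eval2 F x (- x - z) + eval2 F (x + z) y" for x y z
        using eq[of z x y] t s \<open>c \<noteq> 0\<close> by (simp flip: distrib_left)
      obtain p where p: "\<And>x y. eval2 F (- x) (x + y) = poly p x + poly p y - poly p (x + y)"
      proof (rule group_cocycle_coboundary[of F])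
        show "eval2 F (- y) (y + z) + eval2 F (- x) (x + (y + z))
                = eval2 F (- x) (x + y) + eval2 F (- (x + y)) (x + y + z)" for x y z
          using eq'[of "- y" "- x" "x + y + z"] by (simp add: algebra_simps)
      qed blast
      \<comment> \<open>The substitution is undone by taking -x and x + y as the two arguments of
        the cocycle.\<close>
      have "eval2 F x y = poly p (- x) + poly p (x + y) - poly p y" for x y
        using p[of "- x" "x + y"] by simp
      then have "eval2 F x y = s * poly (smult (1 / c) p) (- x) + t * poly (smult (1 / c) p) (x + y)
                   - c * poly (smult (1 / c) p) y" for x y
        using t s \<open>c \<noteq> 0\<close> by simp
      then show ?thesis by blast
    qed
  qed
  with that show thesis by blast
qed

section \<open>Evaluating polynomials with coefficients in a module\<close>

lemma map_poly_add:
  fixes f :: "'a::ab_group_add \<Rightarrow> 'b::ab_group_add"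
  assumes "\<And>u v. f (u + v) = f u + f v"
  shows "map_poly f (p + q) = map_poly f p + map_poly f q"
proof -
  have "f 0 = 0" using assms[of 0 0] by simp
  then show ?thesis by (intro poly_eqI) (simp add: coeff_map_poly assms)
qed

lemma map_poly_minus:
  fixes f :: "'a::ab_group_add \<Rightarrow> 'b::ab_group_add"
  assumes "f 0 = 0" "\<And>u. f (- u) = - f u"
  shows "map_poly f (- p) = - map_poly f p"
  by (intro poly_eqI) (simp add: coeff_map_poly assms)

lemma eval2_altdef:
  "eval2 F x y = (\<Sum>i\<le>degree F. \<Sum>j\<le>degree (coeff F i). coeff (coeff F i) j * (x ^ i * y ^ j))"
  unfolding eval2_def poly_altdef[of F] poly_sum poly_mult poly_power
  by (simp add: poly_altdef[of "coeff F _"] sum_distrib_left sum_distrib_right ac_simps)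

text \<open>\<open>crd\<close> identifies the coefficient module with a submodule of \<open>\<complex>[\<partial>]\<close>; the complex arguments are the
  values of \<open>\<lambda>\<close>, (\<open>\<mu>\<close>,) \<open>\<partial>\<close>.\<close>

definition ev1 :: "('m::ab_group_add \<Rightarrow> complex poly) \<Rightarrow> 'm poly \<Rightarrow> complex \<Rightarrow> complex \<Rightarrow> complex" where
  "ev1 crd p = eval2 (map_poly crd p)"

definition ev2 :: "('m::ab_group_add \<Rightarrow> complex poly) \<Rightarrow> 'm poly poly \<Rightarrow> complex \<Rightarrow> complex \<Rightarrow> complex \<Rightarrow> complex" where
  "ev2 crd X l m = eval2 (poly (map_poly (map_poly crd) X) [:[:m:]:]) l"

text \<open>The maps in a flag datum take coefficients in A or in \<complex>[\<partial>] itself, and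
  both become instances. Injectivity of \<open>crd\<close> allows identities to be checked on
  coordinates.\<close>

locale poly_coordinates =
  fixes s :: "complex poly \<Rightarrow> 'm::ab_group_add \<Rightarrow> 'm" and crd :: "'m \<Rightarrow> complex poly"
  assumes crd_add [simp]: "crd (u + v) = crd u + crd v"
    and crd_scale [simp]: "crd (s p u) = p * crd u"
    and crd_inject [simp]: "crd u = crd v \<longleftrightarrow> u = v"
begin

lemma crd_0 [simp]: "crd 0 = 0"
  using crd_add[of 0 0] by simp

lemma crd_minus [simp]: "crd (- u) = - crd u"
  using crd_add[of u "- u"] by (simp add: eq_neg_iff_add_eq_0 add.commute)

lemma crd_eq_0_iff [simp]: "crd u = 0 \<longleftrightarrow> u = 0"
  using crd_inject[of u 0] by simp

lemma crd_del [simp]: "crd (del s u) = pCons 0 (crd u)"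
  by (simp add: del_def)

lemma scale_zero_right [simp]: "s p 0 = 0"
  using crd_scale[of p 0] crd_inject[of "s p 0" 0] by simp

lemma del_zero [simp]: "del s 0 = 0"
  by (simp add: del_def)

lemma ev1_0 [simp]: "ev1 crd 0 l d = 0"
  and ev1_pCons [simp]: "ev1 crd (pCons u p) l d = poly (crd u) d + l * ev1 crd p l d"
  and ev1_add [simp]: "ev1 crd (p + q) l d = ev1 crd p l d + ev1 crd q l d"
  and ev1_minus [simp]: "ev1 crd (- p) l d = - ev1 crd p l d"
  by (simp_all add: ev1_def map_poly_pCons map_poly_add map_poly_minus)

lemma ev1_diff [simp]: "ev1 crd (p - q) l d = ev1 crd p l d - ev1 crd q l d"
  using ev1_add[of p "- q"] by simp

lemma ev1_map_scale [simp]: "ev1 crd (map_poly (s f) p) l d = poly f d * ev1 crd p l d"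
  by (induction p) (simp_all add: map_poly_pCons algebra_simps)

lemma ev1_map_del [simp]: "ev1 crd (map_poly (del s) p) l d = d * ev1 crd p l d"
  by (induction p) (simp_all add: map_poly_pCons algebra_simps)

lemma ev1_altdef: "ev1 crd p l d = (\<Sum>i\<le>degree p. l ^ i * poly (crd (coeff p i)) d)"
proof -
  have "degree (map_poly crd p) = degree p"
    by (rule degree_map_poly) simp
  then show ?thesis
    by (simp add: ev1_def eval2_def poly_altdef[of "map_poly crd p"] poly_sum coeff_map_poly mult.commute)
qed

lemma ev1_ext:
  assumes "\<And>l d. ev1 crd p l d = ev1 crd q l d"
  shows "p = q"
proof -
  have "map_poly crd p = map_poly crd q"
    using assms by (intro eval2_ext) (simp add: ev1_def)
  then show ?thesis
    by (metis coeff_map_poly crd_0 crd_inject poly_eqI)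
qed

lemma ev2_0 [simp]: "ev2 crd 0 l m d = 0"
  and ev2_pCons [simp]: "ev2 crd (pCons p X) l m d = ev1 crd p l d + m * ev2 crd X l m d"
  and ev2_add [simp]: "ev2 crd (X + Y) l m d = ev2 crd X l m d + ev2 crd Y l m d"
  and ev2_minus [simp]: "ev2 crd (- X) l m d = - ev2 crd X l m d"
  by (simp_all add: ev1_def ev2_def map_poly_pCons map_poly_add map_poly_minus)

lemma ev2_diff [simp]: "ev2 crd (X - Y) l m d = ev2 crd X l m d - ev2 crd Y l m d"
  using ev2_add[of X "- Y"] by simp

lemma ev2_sum [simp]: "ev2 crd (sum f A) l m d = (\<Sum>i\<in>A. ev2 crd (f i) l m d)"
  by (induction A rule: infinite_finite_induct) simp_all

lemma ev2_altdef:
  "ev2 crd X l m d =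
     (\<Sum>j\<le>degree X. \<Sum>i\<le>degree (coeff X j). m ^ j * l ^ i * poly (crd (coeff (coeff X j) i)) d)"
proof -
  have inner: "map_poly crd p = 0 \<longleftrightarrow> p = 0" for p
    by (metis coeff_0 coeff_map_poly crd_0 crd_eq_0_iff poly_eqI)
  have "degree (map_poly (map_poly crd) X) = degree X"
    by (rule degree_map_poly) (simp add: inner)
  then have "ev2 crd X l m d = (\<Sum>j\<le>degree X. m ^ j * ev1 crd (coeff X j) l d)"
    by (simp add: ev1_def ev2_def eval2_def poly_altdef[of "map_poly (map_poly crd) X"] poly_sum
        coeff_map_poly mult.commute)
  then show ?thesis
    by (simp add: ev1_altdef sum_distrib_left mult.assoc)
qed

lemma ev2_mu [simp]: "ev2 crd (mu X) l m d = m * ev2 crd X l m d"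
  by (simp add: mu_def)

lemma ev2_lam [simp]: "ev2 crd (lam X) l m d = l * ev2 crd X l m d"
  by (induction X) (simp_all add: lam_def map_poly_pCons algebra_simps)

lemma ev2_del2 [simp]: "ev2 crd (del2 s X) l m d = d * ev2 crd X l m d"
  by (induction X) (simp_all add: del2_def map_poly_pCons algebra_simps)

lemma ev2_map_scale [simp]: "ev2 crd (map_poly (map_poly (s f)) X) l m d = poly f d * ev2 crd X l m d"
  by (induction X) (simp_all add: map_poly_pCons algebra_simps)

lemma ev2_lam_mu [simp]: "ev2 crd (lam_mu X) l m d = (l + m) * ev2 crd X l m d"
  and ev2_lam_del [simp]: "ev2 crd (lam_del s X) l m d = (l + d) * ev2 crd X l m d"
  and ev2_neg_lam_mu [simp]: "ev2 crd (neg_lam_mu X) l m d = (- l - m) * ev2 crd X l m d"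
  by (simp_all add: lam_mu_def lam_del_def neg_lam_mu_def algebra_simps)

lemma ev2_funpow:
  assumes "\<And>X. ev2 crd (S X) l m d = \<sigma> * ev2 crd X l m d"
  shows "ev2 crd ((S ^^ n) X) l m d = \<sigma> ^ n * ev2 crd X l m d"
  by (induction n) (simp_all add: assms)

text \<open>At a fixed point a substitution operator acts as multiplication by a number
  \<open>\<sigma>\<close>, so replacing \<lambda> by \<open>S\<close> becomes evaluation at
  \<open>\<sigma>\<close>.\<close>

lemma ev2_subs:
  assumes "\<And>X. ev2 crd (S X) l m d = \<sigma> * ev2 crd X l m d"
  shows "ev2 crd (subs S p) l m d = ev1 crd p \<sigma> d"
  by (simp add: subs_def ev2_funpow[OF assms] ev1_altdef)

lemma ev2_act:
  assumes "\<And>X. ev2 crd (U X) l m d = u * ev2 crd X l m d"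
    and "\<And>X. ev2 crd (W X) l m d = w * ev2 crd X l m d"
  shows "ev2 crd (act s F U W X) l m d = eval2 F u w * ev2 crd X l m d"
  by (simp add: act_def ev2_funpow[OF assms(1)] ev2_funpow[OF assms(2)] eval2_altdef
      sum_distrib_right mult.assoc)

lemma ev2_subs_lam [simp]: "ev2 crd (subs lam p) l m d = ev1 crd p l d"
  and ev2_subs_mu [simp]: "ev2 crd (subs mu p) l m d = ev1 crd p m d"
  and ev2_subs_lam_mu [simp]: "ev2 crd (subs lam_mu p) l m d = ev1 crd p (l + m) d"
  by (simp_all add: ev2_subs)

lemma ev2_act_left [simp]:
    "ev2 crd (act s F mu (lam_del s) X) l m d = eval2 F m (l + d) * ev2 crd X l m d"
  and ev2_act_right [simp]:
    "ev2 crd (act s F lam neg_lam_mu X) l m d = eval2 F l (- l - m) * ev2 crd X l m d"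
  by (rule ev2_act; simp)+

text \<open>If at the given point \<open>\<phi>\<close> acts by evaluating \<partial> at
  \<open>y\<close> and multiplying by \<open>F\<close>, so does its coefficientwise extension. For
  left conformal maps \<open>y\<close> will be - l - m, for right conformal ones l + d.\<close>

lemma ev2_ext_map:
  assumes "poly_coordinates t crd'"
    and "\<And>X. ev2 crd (S X) l m d = \<sigma> * ev2 crd X l m d"
    and "\<And>u. ev1 crd (\<phi> u) \<sigma> d = poly (crd' u) y * F"
  shows "ev2 crd (ext \<phi> S X) l m d = ev2 crd' X l m y * F"
proof -
  interpret dom: poly_coordinates t crd' by fact
  show ?thesis
    by (simp add: ext_def ev2_funpow[OF ev2_lam] ev2_funpow[OF ev2_mu] ev2_subs[OF assms(2)] assms(3) dom.ev2_altdef
        sum_distrib_right mult.assoc)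
qed

text \<open>Evaluation is faithful: the outer variable is tested at complex numbers embedded as
  double constants, the other two by \<open>eval2_ext\<close>.\<close>

lemma ev2_ext:
  assumes "\<And>l m d. ev2 crd X l m d = ev2 crd Y l m d"
  shows "X = Y"
proof -
  have "map_poly (map_poly crd) X = map_poly (map_poly crd) Y"
    using assms by (intro poly_ext_inj[of "\<lambda>m. [:[:m:]:]"] eval2_ext) (simp_all add: ev2_def inj_def)
  then have "coeff (coeff (map_poly (map_poly crd) X) j) i = coeff (coeff (map_poly (map_poly crd) Y) j) i" for i j
    by simp
  then have "crd (coeff (coeff X j) i) = crd (coeff (coeff Y j) i)" for i j
    by (simp add: coeff_map_poly)
  then show ?thesis
    by (intro poly_eqI) simp
qed

lemma ev2_eq_iff: "X = Y \<longleftrightarrow> (\<forall>l m d. ev2 crd X l m d = ev2 crd Y l m d)"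
  using ev2_ext by blast

end

interpretation ident: poly_coordinates "(*)" id
  by unfold_locales simp_all

lemma ev1_id [simp]: "ev1 id = eval2"
  by (intro ext) (simp add: ev1_def)

section \<open>Conformal linear maps on a free module of rank one\<close>

locale free_rank_one = module s + poly_coordinates s crd
  for s :: "complex poly \<Rightarrow> 'm::ab_group_add \<Rightarrow> 'm" and crd :: "'m \<Rightarrow> complex poly" +
  fixes e :: 'm
  assumes crd_generator [simp]: "crd e = 1"
begin

lemma scale_crd: "s (crd u) e = u"
  using crd_inject[of "s (crd u) e" u] by simp

text \<open>This is Horner's scheme for the coordinate polynomial of \<open>u\<close>. The step uses
  just the operations by which conformal linear maps are specified.\<close>

lemma generator_induct [case_names zero step]:
  assumes "P 0" and step: "\<And>c u. P u \<Longrightarrow> P (s [:c:] e + del s u)"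
  shows "P u"
proof -
  have "P (s p e)" for p
  proof (induction p)
    case (pCons c p)
    have "s (pCons c p) e = s [:c:] e + del s (s p e)"
      by (rule crd_inject[THEN iffD1]) simp
    then show ?case
      by (simp only: step[OF pCons.IH])
  next
    case 0
    show ?case using \<open>P 0\<close> unfolding scale_zero_left .
  qed
  from this[of "crd u"] show ?thesis
    by (simp only: scale_crd)
qed

text \<open>Each \<partial> leaves the argument as -\<lambda>, hence \<phi>(f(\<partial>)e) =
  f(-\<lambda>)\<phi>(e).\<close>

lemma left_conformal_iff:
  assumes "poly_coordinates t crd'"
  shows "left_conformal s t \<phi> \<longleftrightarrow>
    (\<forall>u l d. ev1 crd' (\<phi> u) l d = poly (crd u) (- l) * ev1 crd' (\<phi> e) l d)"
proof -
  interpret cod: poly_coordinates t crd' by fact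
  show ?thesis
  proof (intro iffI allI)
    fix u l d
    assume \<phi>: "left_conformal s t \<phi>"
    then have add: "\<phi> (u + w) = \<phi> u + \<phi> w" and scale: "\<phi> (s [:c:] u) = map_poly (t [:c:]) (\<phi> u)"
      and del: "\<phi> (del s u) = - pCons 0 (\<phi> u)" for u w c
      by (auto simp: left_conformal_def complex_linear_def)
    show "ev1 crd' (\<phi> u) l d = poly (crd u) (- l) * ev1 crd' (\<phi> e) l d"
    proof (induction u rule: generator_induct)
      case zero
      from add[of 0 0] have "\<phi> 0 = 0" by simp
      then show ?case by simp
    next
      case (step c u)
      have "ev1 crd' (\<phi> (s [:c:] e + del s u)) l d = c * ev1 crd' (\<phi> e) l d + - l * ev1 crd' (\<phi> u) l d"
        unfolding add scale del by (simp add: algebra_simps)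
      also have "\<dots> = (c + - l * poly (crd u) (- l)) * ev1 crd' (\<phi> e) l d"
        unfolding step.IH by (simp add: algebra_simps)
      finally show ?case by simp
    qed
  next
    assume "\<forall>u l d. ev1 crd' (\<phi> u) l d = poly (crd u) (- l) * ev1 crd' (\<phi> e) l d"
    \<comment> \<open>The factor is abstracted to \<open>F\<close> because the value at
      \<open>e\<close> is itself an instance of the left side, so the equation would loop as a
      rewrite rule.\<close>
    then have "\<exists>F. \<forall>u l d. ev1 crd' (\<phi> u) l d = poly (crd u) (- l) * F l d"
      by (rule exI[where x = "ev1 crd' (\<phi> e)"])
    then obtain F where "\<And>u l d. ev1 crd' (\<phi> u) l d = poly (crd u) (- l) * F l d"
      by blast
    then show "left_conformal s t \<phi>"
      unfolding left_conformal_def complex_linear_def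
      by (intro conjI allI cod.ev1_ext)
         (simp_all add: algebra_simps)
  qed
qed

text \<open>As for left conformal maps, but \<partial> leaves the argument as \<lambda> +
  \<partial>.\<close>

lemma right_conformal_iff:
  assumes "poly_coordinates t crd'"
  shows "right_conformal s t \<phi> \<longleftrightarrow>
    (\<forall>u l d. ev1 crd' (\<phi> u) l d = poly (crd u) (l + d) * ev1 crd' (\<phi> e) l d)"
proof -
  interpret cod: poly_coordinates t crd' by fact
  show ?thesis
  proof (intro iffI allI)
    fix u l d
    assume \<phi>: "right_conformal s t \<phi>"
    then have add: "\<phi> (u + w) = \<phi> u + \<phi> w" and scale: "\<phi> (s [:c:] u) = map_poly (t [:c:]) (\<phi> u)"
      and del: "\<phi> (del s u) = map_poly (del t) (\<phi> u) + pCons 0 (\<phi> u)" for u w c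
      by (auto simp: right_conformal_def complex_linear_def)
    show "ev1 crd' (\<phi> u) l d = poly (crd u) (l + d) * ev1 crd' (\<phi> e) l d"
    proof (induction u rule: generator_induct)
      case zero
      from add[of 0 0] have "\<phi> 0 = 0" by simp
      then show ?case by simp
    next
      case (step c u)
      have "ev1 crd' (\<phi> (s [:c:] e + del s u)) l d = c * ev1 crd' (\<phi> e) l d + (l + d) * ev1 crd' (\<phi> u) l d"
        unfolding add scale del by (simp add: algebra_simps)
      also have "\<dots> = (c + (l + d) * poly (crd u) (l + d)) * ev1 crd' (\<phi> e) l d"
        unfolding step.IH by (simp add: algebra_simps)
      finally show ?case by simp
    qed
  next
    assume "\<forall>u l d. ev1 crd' (\<phi> u) l d = poly (crd u) (l + d) * ev1 crd' (\<phi> e) l d"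
    then have "\<exists>F. \<forall>u l d. ev1 crd' (\<phi> u) l d = poly (crd u) (l + d) * F l d"
      by (rule exI[where x = "ev1 crd' (\<phi> e)"])
    then obtain F where "\<And>u l d. ev1 crd' (\<phi> u) l d = poly (crd u) (l + d) * F l d"
      by blast
    then show "right_conformal s t \<phi>"
      unfolding right_conformal_def complex_linear_def
      by (intro conjI allI cod.ev1_ext)
         (simp_all add: algebra_simps)
  qed
qed

lemma ev2_ext_left_conformal:
  assumes "poly_coordinates t crd'" "left_conformal s t \<phi>"
  shows "ev2 crd' (ext \<phi> lam_mu X) l m d = ev2 crd X l m (- l - m) * ev1 crd' (\<phi> e) (l + m) d"
proof -
  interpret cod: poly_coordinates t crd' by fact
  have "ev1 crd' (\<phi> u) (l + m) d = poly (crd u) (- l - m) * ev1 crd' (\<phi> e) (l + m) d" for u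
    using assms(2) unfolding left_conformal_iff[OF assms(1)] by (metis minus_add_distrib diff_conv_add_uminus)
  then show ?thesis
    by (rule cod.ev2_ext_map[OF poly_coordinates_axioms, rotated]) simp
qed

lemma ev2_ext_right_conformal:
  assumes "poly_coordinates t crd'" "right_conformal s t \<phi>"
  shows "ev2 crd' (ext \<phi> lam X) l m d = ev2 crd X l m (l + d) * ev1 crd' (\<phi> e) l d"
proof -
  interpret cod: poly_coordinates t crd' by fact
  have "ev1 crd' (\<phi> u) l d = poly (crd u) (l + d) * ev1 crd' (\<phi> e) l d" for u
    using assms(2) unfolding right_conformal_iff[OF assms(1)] by blast
  then show ?thesis
    by (rule cod.ev2_ext_map[OF poly_coordinates_axioms, rotated]) simp
qed

end

lemma ext_zero_map [simp]: "ext (\<lambda>_. 0) S X = 0"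
proof -
  have "(mu ^^ n) 0 = (0 :: 'a poly poly)" "(lam ^^ n) 0 = (0 :: 'a poly poly)" for n
    by (induction n) (simp_all add: mu_def lam_def)
  then show ?thesis
    by (simp add: ext_def subs_def)
qed

section \<open>Flag datums of the null algebra of rank one\<close>

locale null_rank_one = assoc_conformal_algebra dm lp + free_rank_one dm crd e
  for dm :: "complex poly \<Rightarrow> 'a::ab_group_add \<Rightarrow> 'a" and lp crd e +
  fixes V :: "'a set"
  assumes lp_generator: "lp e e = 0"
    and V_def: "V = {dm [:c:] e | c. True}"
begin

text \<open>Conformal linearity in each slot makes every evaluated product a multiple of that of
  \<open>lp e e\<close>.\<close>

lemma lp_null: "lp = (\<lambda>a b. 0)"
proof (intro ext ev1_ext)
  fix a b l d
  have "ev1 crd (lp a b) l d = poly (crd a) (- l) * ev1 crd (lp e b) l d"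
    using left_conformal_lp[of b] unfolding left_conformal_iff[OF poly_coordinates_axioms] by blast
  also have "ev1 crd (lp e b) l d = poly (crd b) (l + d) * ev1 crd (lp e e) l d"
    using right_conformal_lp[of e] unfolding right_conformal_iff[OF poly_coordinates_axioms] by blast
  finally show "ev1 crd (lp a b) l d = ev1 crd 0 l d"
    by (simp add: lp_generator)
qed

lemma generator_in_V: "e \<in> V"
proof -
  have "dm [:1:] e = e"
    using scale_one[of e] by (simp only: one_pCons)
  then show ?thesis
    unfolding V_def by (intro CollectI exI[of _ 1] conjI TrueI) (rule sym)
qed

lemmas ev1_left_conformal = left_conformal_iff[THEN iffD1, rule_format]
  and ev1_right_conformal = right_conformal_iff[THEN iffD1, rule_format]

text \<open>The x-components of a(bx) = (ab)x and x(ab) = (xa)b are quadratic equations with zero on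
  the side containing ab. They are two of the product equations above, with c = 0.\<close>

lemma flag_datum_zero:
  assumes "flag_datum V (h, D, g, T, Q, P)"
  shows "h = (\<lambda>_. 0)" "g = (\<lambda>_. 0)"
proof -
  have h: "left_conformal dm (*) h" and g: "right_conformal dm (*) g"
    and hh: "act (*) (h e) mu (lam_del (*)) (subs lam (h e)) = ext h lam_mu (subs lam 0)"
    and gg: "ext g lam (subs mu 0) = act (*) (g e) lam neg_lam_mu (subs lam_mu (g e))"
    using assms generator_in_V unfolding flag_datum_def prod.case
    unfolding lp_null by blast+
  have "eval2 (h e) m (l + d) * eval2 (h e) l d = 0 * eval2 (h e) (l + m) d" for l m d
    using arg_cong[OF hh, of "\<lambda>X. ev2 id X l m d"]
    by (simp add: ev2_ext_left_conformal[OF ident.poly_coordinates_axioms h])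
  then have "eval2 (h e) l d = 0" for l d
    using shift_product_const[of "h e" 0] by simp
  then have "ev1 id (h u) l d = ev1 id 0 l d" for u l d
    using ev1_left_conformal[OF ident.poly_coordinates_axioms h, of u l d] by simp
  then show "h = (\<lambda>_. 0)"
    by (intro ext ident.ev1_ext)
  \<comment> \<open>Here \<open>k\<close> stands for \<lambda> + \<mu>, which becomes the middle
    variable.\<close>
  have "eval2 (g e) l (- k) * eval2 (g e) k d = 0 * eval2 (g e) l d" for l k d
    using arg_cong[OF gg, of "\<lambda>X. ev2 id X l (k - l) d"]
    by (simp add: ev2_ext_right_conformal[OF ident.poly_coordinates_axioms g])
  then have "eval2 (g e) l d = 0" for l d
    using middle_product_const[of "g e" 0] by simp
  then have "ev1 id (g u) l d = ev1 id 0 l d" for u l d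
    using ev1_right_conformal[OF ident.poly_coordinates_axioms g, of u l d] by simp
  then show "g = (\<lambda>_. 0)"
    by (intro ext ident.ev1_ext)
qed

text \<open>What survives is associativity on the triples (a,x,x), (x,a,x) and (x,x,a) in the
  A-component, and on (x,x,x) in both components. Testing at \<open>e\<close> is enough because
  \<open>V\<close> consists of its complex multiples.\<close>

lemma flag_datum_iff:
  assumes D: "left_conformal dm dm D" and T: "right_conformal dm dm T"
  shows "flag_datum V (\<lambda>_. 0, D, \<lambda>_. 0, T, Q, P) \<longleftrightarrow>
    (\<forall>l m d.
      eval2 P m (l + d) * ev1 crd (D e) l d = ev1 crd (D e) l (- l - m) * ev1 crd (D e) (l + m) d \<and>
      ev1 crd (D e) m (l + d) * ev1 crd (T e) l d = ev1 crd (T e) l (- l - m) * ev1 crd (D e) (l + m) d \<and>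
      ev1 crd (T e) m (l + d) * ev1 crd (T e) l d = eval2 P l (- l - m) * ev1 crd (T e) (l + m) d \<and>
      ev1 crd Q m (l + d) * ev1 crd (T e) l d + eval2 P m (l + d) * ev1 crd Q l d
        = ev1 crd Q l (- l - m) * ev1 crd (D e) (l + m) d + eval2 P l (- l - m) * ev1 crd Q (l + m) d \<and>
      eval2 P m (l + d) * eval2 P l d = eval2 P l (- l - m) * eval2 P (l + m) d)"
    (is "_ \<longleftrightarrow> (\<forall>l m d. ?eqs l m d)")
proof -
  note ev = ev2_ext_left_conformal[OF poly_coordinates_axioms D]
    ev2_ext_right_conformal[OF poly_coordinates_axioms T] ev2_eq_iff ident.ev2_eq_iff
  show ?thesis
  proof
    assume F: "flag_datum V (\<lambda>_. 0, D, \<lambda>_. 0, T, Q, P)"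
    then show "\<forall>l m d. ?eqs l m d"
      using bspec[OF _ generator_in_V] unfolding flag_datum_def prod.case
      unfolding lp_null by (simp add: ev generator_in_V)
  next
    assume eqs: "\<forall>l m d. ?eqs l m d"
    have zero: "left_conformal dm (*) (\<lambda>_. 0)" "right_conformal dm (*) (\<lambda>_. 0)"
      by (simp_all add: left_conformal_iff[OF ident.poly_coordinates_axioms]
          right_conformal_iff[OF ident.poly_coordinates_axioms])
    have crd_V: "poly (crd a) x = coeff (crd a) 0" if "a \<in> V" for a x
      using that by (auto simp: V_def)
    have Da: "ev1 crd (D a) l d = coeff (crd a) 0 * ev1 crd (D e) l d"
      and Ta: "ev1 crd (T a) l d = coeff (crd a) 0 * ev1 crd (T e) l d" if "a \<in> V" for a l d
      using ev1_left_conformal[OF poly_coordinates_axioms D, of a]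
        ev1_right_conformal[OF poly_coordinates_axioms T, of a] by (simp_all only: crd_V[OF that])
    show "flag_datum V (\<lambda>_. 0, D, \<lambda>_. 0, T, Q, P)"
      unfolding flag_datum_def prod.case
      unfolding lp_null
      by (intro conjI ballI zero D T)
         (insert eqs, simp_all add: ev Da Ta mult.left_commute[of _ "coeff (crd _) 0"])
  qed
qed

section \<open>Equivalence of flag datums in coordinates\<close>

lemma ev1_pmul [simp]: "ev1 crd (pmul F u) l d = eval2 F l d * poly (crd u) d"
  by (induction F) (simp_all add: pmul_def map_poly_pCons algebra_simps)

lemma ev1_cmul [simp]: "ev1 crd (cmul c p) l d = c * ev1 crd p l d"
  by (simp add: cmul_def)

lemma flag_datumE:
  assumes "flag_datum V F"
  obtains D T Q P where "F = (\<lambda>_. 0, D, \<lambda>_. 0, T, Q, P)"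
    "left_conformal dm dm D" "right_conformal dm dm T"
proof -
  obtain h D g T Q P where F: "F = (h, D, g, T, Q, P)"
    by (cases F)
  with assms have "left_conformal dm dm D" "right_conformal dm dm T"
    by (simp_all add: flag_datum_def)
  with F flag_datum_zero[OF assms[unfolded F]] that show thesis by simp
qed

text \<open>\<open>p\<close> is the coordinate polynomial of T0. Since the product and the maps h
  and g vanish, T0 enters through the equation for Q0 alone.\<close>

lemma flag_equiv_iff:
  assumes D: "left_conformal dm dm D" and D': "left_conformal dm dm D'"
    and T: "right_conformal dm dm T" and T': "right_conformal dm dm T'"
  shows "flag_equiv (\<lambda>_. 0, D, \<lambda>_. 0, T, Q, P) (\<lambda>_. 0, D', \<lambda>_. 0, T', Q', P') \<longleftrightarrow>
    (\<exists>p \<beta>. \<beta> \<noteq> 0 \<and> (\<forall>l d.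
      ev1 crd (D e) l d = \<beta> * ev1 crd (D' e) l d \<and>
      ev1 crd (T e) l d = \<beta> * ev1 crd (T' e) l d \<and>
      eval2 P l d = \<beta> * eval2 P' l d \<and>
      ev1 crd Q l d = \<beta> * (poly p (- l) * ev1 crd (D' e) l d + poly p (l + d) * ev1 crd (T' e) l d)
        + \<beta>\<^sup>2 * ev1 crd Q' l d - eval2 P l d * poly p d))"
    (is "_ \<longleftrightarrow> (\<exists>p \<beta>. \<beta> \<noteq> 0 \<and> ?eqs p \<beta>)")
proof -
  note evD = ev1_left_conformal[OF poly_coordinates_axioms D]
    and evD' = ev1_left_conformal[OF poly_coordinates_axioms D']
    and evT = ev1_right_conformal[OF poly_coordinates_axioms T]
    and evT' = ev1_right_conformal[OF poly_coordinates_axioms T']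
  have D_iff: "(\<forall>a. D a = cmul \<beta> (D' a)) \<longleftrightarrow> (\<forall>l d. ev1 crd (D e) l d = \<beta> * ev1 crd (D' e) l d)" for \<beta>
  proof (intro iffI allI ev1_ext)
    fix a l d assume "\<forall>l d. ev1 crd (D e) l d = \<beta> * ev1 crd (D' e) l d"
    then show "ev1 crd (D a) l d = ev1 crd (cmul \<beta> (D' a)) l d"
      using evD[of a l d] evD'[of a l d] by simp
  qed simp
  have T_iff: "(\<forall>a. T a = cmul \<beta> (T' a)) \<longleftrightarrow> (\<forall>l d. ev1 crd (T e) l d = \<beta> * ev1 crd (T' e) l d)" for \<beta>
  proof (intro iffI allI ev1_ext)
    fix a l d assume "\<forall>l d. ev1 crd (T e) l d = \<beta> * ev1 crd (T' e) l d"
    then show "ev1 crd (T a) l d = ev1 crd (cmul \<beta> (T' a)) l d"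
      using evT[of a l d] evT'[of a l d] by simp
  qed simp
  have P_iff: "P = smult [:\<beta>:] P' \<longleftrightarrow> (\<forall>l d. eval2 P l d = \<beta> * eval2 P' l d)" for \<beta>
    using eval2_ext[of P "smult [:\<beta>:] P'"] by auto
  have Q_iff: "Q = cmul \<beta> (D' u) + cmul \<beta> (T' u) + cmul (\<beta>\<^sup>2) Q' - pmul P u \<longleftrightarrow>
     (\<forall>l d. ev1 crd Q l d =
        \<beta> * (poly (crd u) (- l) * ev1 crd (D' e) l d + poly (crd u) (l + d) * ev1 crd (T' e) l d)
        + \<beta>\<^sup>2 * ev1 crd Q' l d - eval2 P l d * poly (crd u) d)" (is "_ = ?R \<longleftrightarrow> _") for \<beta> u
  proof -
    have "ev1 crd ?R l d =
        \<beta> * (poly (crd u) (- l) * ev1 crd (D' e) l d + poly (crd u) (l + d) * ev1 crd (T' e) l d)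
        + \<beta>\<^sup>2 * ev1 crd Q' l d - eval2 P l d * poly (crd u) d" for l d
      using evD'[of u l d] evT'[of u l d] by (simp add: algebra_simps)
    then show ?thesis
      using ev1_ext[of Q ?R] by metis
  qed
  have pmul_0: "pmul 0 u = 0" for u
    by (simp add: pmul_def)
  have "flag_equiv (\<lambda>_. 0, D, \<lambda>_. 0, T, Q, P) (\<lambda>_. 0, D', \<lambda>_. 0, T', Q', P') \<longleftrightarrow>
      (\<exists>u \<beta>. \<beta> \<noteq> 0 \<and> (\<forall>a. D a = cmul \<beta> (D' a)) \<and> (\<forall>a. T a = cmul \<beta> (T' a)) \<and>
        P = smult [:\<beta>:] P' \<and> Q = cmul \<beta> (D' u) + cmul \<beta> (T' u) + cmul (\<beta>\<^sup>2) Q' - pmul P u)"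
    unfolding flag_equiv_def prod.case unfolding lp_null
    by (simp only: pmul_0 add_0 diff_zero simp_thms)
  also have "\<dots> \<longleftrightarrow> (\<exists>u \<beta>. \<beta> \<noteq> 0 \<and> ?eqs (crd u) \<beta>)"
    unfolding D_iff T_iff P_iff Q_iff by (simp only: all_conj_distrib)
  also have "\<dots> \<longleftrightarrow> (\<exists>p \<beta>. \<beta> \<noteq> 0 \<and> ?eqs p \<beta>)"
  proof
    assume "\<exists>p \<beta>. \<beta> \<noteq> 0 \<and> ?eqs p \<beta>"
    \<comment> \<open>Every polynomial is a coordinate, namely that of
      \<open>dm p e\<close>.\<close>
    then obtain p \<beta> where "\<beta> \<noteq> 0 \<and> ?eqs (crd (dm p e)) \<beta>"
      by auto
    then show "\<exists>u \<beta>. \<beta> \<noteq> 0 \<and> ?eqs (crd u) \<beta>"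
      by (intro exI)
  qed (elim exE, intro exI)
  finally show ?thesis .
qed

text \<open>A pair \<open>p\<close>, \<open>\<beta>\<close> records the change of generator x =
  p(\<partial>)e + \<beta>x'. The identity, inverses and composites of such changes supply the
  witnesses.\<close>

lemma equiv_flag_rel: "equiv {F. flag_datum V F} (flag_rel V)"
proof (rule equivI)
  show "flag_rel V \<subseteq> {F. flag_datum V F} \<times> {F. flag_datum V F}"
    by (auto simp: flag_rel_def)
  show "refl_on {F. flag_datum V F} (flag_rel V)"
  proof (rule refl_onI)
    fix F assume "F \<in> {F. flag_datum V F}"
    then have F: "flag_datum V F" by simp
    then obtain D T Q P where "F = (\<lambda>_. 0, D, \<lambda>_. 0, T, Q, P)"
      "left_conformal dm dm D" "right_conformal dm dm T"
      by (rule flag_datumE)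
    then have "flag_equiv F F"
      by (simp add: flag_equiv_iff exI[of _ 0] exI[of _ 1])
    with F show "(F, F) \<in> flag_rel V"
      by (simp add: flag_rel_def)
  qed
  show "sym (flag_rel V)"
  proof (rule symI)
    fix F F' assume "(F, F') \<in> flag_rel V"
    then have F: "flag_datum V F" and F': "flag_datum V F'" and eq: "flag_equiv F F'"
      by (simp_all add: flag_rel_def)
    from F obtain D T Q P where DT: "F = (\<lambda>_. 0, D, \<lambda>_. 0, T, Q, P)"
      "left_conformal dm dm D" "right_conformal dm dm T"
      by (rule flag_datumE)
    from F' obtain D' T' Q' P' where DT': "F' = (\<lambda>_. 0, D', \<lambda>_. 0, T', Q', P')"
      "left_conformal dm dm D'" "right_conformal dm dm T'"
      by (rule flag_datumE)
    from eq obtain p \<beta> where \<beta>: "\<beta> \<noteq> 0" and eqs: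
      "\<And>l d. ev1 crd (D e) l d = \<beta> * ev1 crd (D' e) l d"
      "\<And>l d. ev1 crd (T e) l d = \<beta> * ev1 crd (T' e) l d"
      "\<And>l d. eval2 P l d = \<beta> * eval2 P' l d"
      "\<And>l d. ev1 crd Q l d = \<beta> * (poly p (- l) * ev1 crd (D' e) l d + poly p (l + d) * ev1 crd (T' e) l d)
        + \<beta>\<^sup>2 * ev1 crd Q' l d - eval2 P l d * poly p d"
      unfolding DT(1) DT'(1) flag_equiv_iff[OF DT(2) DT'(2) DT(3) DT'(3)] by blast
    \<comment> \<open>The inverse change is x' = -(1/\<beta>)p(\<partial>)e + (1/\<beta>)x.\<close>
    have "flag_equiv F' F"
      unfolding DT(1) DT'(1) flag_equiv_iff[OF DT'(2) DT(2) DT'(3) DT(3)]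
      by (rule exI[of _ "smult (- 1 / \<beta>) p"], rule exI[of _ "1 / \<beta>"])
         (use \<beta> in \<open>simp add: eqs field_simps power2_eq_square\<close>)
    with F F' show "(F', F) \<in> flag_rel V"
      by (simp add: flag_rel_def)
  qed
  show "trans (flag_rel V)"
  proof (rule transI)
    fix F F' F'' assume "(F, F') \<in> flag_rel V" "(F', F'') \<in> flag_rel V"
    then have F: "flag_datum V F" and F': "flag_datum V F'" and F'': "flag_datum V F''"
      and eq: "flag_equiv F F'" and eq': "flag_equiv F' F''"
      by (simp_all add: flag_rel_def)
    from F obtain D T Q P where DT: "F = (\<lambda>_. 0, D, \<lambda>_. 0, T, Q, P)"
      "left_conformal dm dm D" "right_conformal dm dm T"
      by (rule flag_datumE)
    from F' obtain D' T' Q' P' where DT': "F' = (\<lambda>_. 0, D', \<lambda>_. 0, T', Q', P')"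
      "left_conformal dm dm D'" "right_conformal dm dm T'"
      by (rule flag_datumE)
    from F'' obtain D'' T'' Q'' P'' where DT'': "F'' = (\<lambda>_. 0, D'', \<lambda>_. 0, T'', Q'', P'')"
      "left_conformal dm dm D''" "right_conformal dm dm T''"
      by (rule flag_datumE)
    from eq obtain p \<beta> where \<beta>: "\<beta> \<noteq> 0" and eqs:
      "\<And>l d. ev1 crd (D e) l d = \<beta> * ev1 crd (D' e) l d"
      "\<And>l d. ev1 crd (T e) l d = \<beta> * ev1 crd (T' e) l d"
      "\<And>l d. eval2 P l d = \<beta> * eval2 P' l d"
      "\<And>l d. ev1 crd Q l d = \<beta> * (poly p (- l) * ev1 crd (D' e) l d + poly p (l + d) * ev1 crd (T' e) l d)
        + \<beta>\<^sup>2 * ev1 crd Q' l d - eval2 P l d * poly p d"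
      unfolding DT(1) DT'(1) flag_equiv_iff[OF DT(2) DT'(2) DT(3) DT'(3)] by blast
    from eq' obtain q \<gamma> where \<gamma>: "\<gamma> \<noteq> 0" and eqs':
      "\<And>l d. ev1 crd (D' e) l d = \<gamma> * ev1 crd (D'' e) l d"
      "\<And>l d. ev1 crd (T' e) l d = \<gamma> * ev1 crd (T'' e) l d"
      "\<And>l d. eval2 P' l d = \<gamma> * eval2 P'' l d"
      "\<And>l d. ev1 crd Q' l d = \<gamma> * (poly q (- l) * ev1 crd (D'' e) l d + poly q (l + d) * ev1 crd (T'' e) l d)
        + \<gamma>\<^sup>2 * ev1 crd Q'' l d - eval2 P' l d * poly q d"
      unfolding DT'(1) DT''(1) flag_equiv_iff[OF DT'(2) DT''(2) DT'(3) DT''(3)] by blast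
    \<comment> \<open>Substituting x' = q(\<partial>)e + \<gamma>x'' gives x = (p +
      \<beta>q)(\<partial>)e + \<beta>\<gamma>x''.\<close>
    have "flag_equiv F F''"
      unfolding DT(1) DT''(1) flag_equiv_iff[OF DT(2) DT''(2) DT(3) DT''(3)]
      by (rule exI[of _ "p + smult \<beta> q"], rule exI[of _ "\<beta> * \<gamma>"])
         (use \<beta> \<gamma> in \<open>simp add: eqs eqs' algebra_simps power2_eq_square\<close>)
    with F F'' show "(F, F'') \<in> flag_rel V"
      by (simp add: flag_rel_def)
  qed
qed

section \<open>Existence and equivalence of the listed kinds\<close>

lemma ex_left_conformal: "\<exists>\<phi>. left_conformal dm dm \<phi> \<and> \<phi> e = [:e:]"
proof -
  \<comment> \<open>This is f(-\<lambda>)e for u = f(\<partial>)e; \<open>map_poly\<close> turns the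
    scalars into constants of \<complex>[\<partial>], so that the variable is read as
    \<lambda>.\<close>
  define \<phi> where "\<phi> u = pmul (map_poly (\<lambda>c. [:c:]) (pcompose (crd u) [:0, -1:])) e" for u
  have "eval2 (map_poly (\<lambda>c. [:c:]) p) l d = poly p l" for p l d
    by (induction p) (simp_all add: map_poly_pCons)
  then have ev: "ev1 crd (\<phi> u) l d = poly (crd u) (- l)" for u l d
    by (simp add: \<phi>_def poly_pcompose)
  then have "left_conformal dm dm \<phi>"
    by (simp add: left_conformal_iff[OF poly_coordinates_axioms])
  moreover have "\<phi> e = [:e:]"
    by (rule ev1_ext) (simp add: ev)
  ultimately show ?thesis by blast
qed

lemma ex_right_conformal: "\<exists>\<phi>. right_conformal dm dm \<phi> \<and> \<phi> e = [:e:]"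
proof -
  \<comment> \<open>Composing with the polynomial \<partial> + \<lambda> gives f(\<lambda> +
    \<partial>)e.\<close>
  define \<phi> where "\<phi> u = pmul (pcompose (map_poly (\<lambda>c. [:c:]) (crd u)) [:[:0, 1:], 1:]) e" for u
  have "poly (poly (map_poly (\<lambda>c. [:c:]) p) q) d = poly p (poly q d)" for p q :: "complex poly" and d
    by (induction p) (simp_all add: map_poly_pCons)
  then have ev: "ev1 crd (\<phi> u) l d = poly (crd u) (l + d)" for u l d
    by (simp add: \<phi>_def eval2_def poly_pcompose add.commute)
  then have "right_conformal dm dm \<phi>"
    by (simp add: right_conformal_iff[OF poly_coordinates_axioms])
  moreover have "\<phi> e = [:e:]"
    by (rule ev1_ext) (simp add: ev)
  ultimately show ?thesis by blast
qed

lemma conformal_zero: "left_conformal dm dm (\<lambda>_. 0)" "right_conformal dm dm (\<lambda>_. 0)"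
  by (simp_all add: left_conformal_iff[OF poly_coordinates_axioms]
      right_conformal_iff[OF poly_coordinates_axioms])

lemma flag_datum_kind1: "flag_datum V (\<lambda>_. 0, \<lambda>_. 0, \<lambda>_. 0, \<lambda>_. 0, Q, 0)"
  by (simp add: flag_datum_iff[OF conformal_zero])

text \<open>For these constants the surviving equations reduce to s = s^2, t = t^2 and st =
  ts.\<close>

lemma flag_datum_kinds2_5:
  assumes "left_conformal dm dm D" "ev1 crd (D e) = (\<lambda>_ _. s)" "s \<in> {0, 1}"
    and "right_conformal dm dm T" "ev1 crd (T e) = (\<lambda>_ _. t)" "t \<in> {0, 1}"
  shows "flag_datum V (\<lambda>_. 0, D, \<lambda>_. 0, T, 0, 1)"
  using assms by (auto simp: flag_datum_iff)

text \<open>Rescaling the generator by a factor multiplies Q0 by its square, and every nonzero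
  complex number is such a square.\<close>

lemma flag_equiv_kind1_iff:
  "flag_equiv (\<lambda>_. 0, \<lambda>_. 0, \<lambda>_. 0, \<lambda>_. 0, pmul Q e, 0) (\<lambda>_. 0, \<lambda>_. 0, \<lambda>_. 0, \<lambda>_. 0, pmul Q' e, 0) \<longleftrightarrow>
    (\<exists>\<beta>. \<beta> \<noteq> 0 \<and> Q = smult [:\<beta>:] Q')"
proof -
  have eq: "Q = smult [:\<beta>:] Q' \<longleftrightarrow> (\<forall>l d. eval2 Q l d = \<beta> * eval2 Q' l d)" for \<beta>
    using eval2_ext[of Q "smult [:\<beta>:] Q'"] by auto
  have "(\<exists>\<beta>::complex. \<beta> \<noteq> 0 \<and> (\<forall>l d. eval2 Q l d = \<beta>\<^sup>2 * eval2 Q' l d)) \<longleftrightarrow>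
        (\<exists>\<beta>. \<beta> \<noteq> 0 \<and> (\<forall>l d. eval2 Q l d = \<beta> * eval2 Q' l d))"
  proof
    assume "\<exists>\<beta>. \<beta> \<noteq> 0 \<and> (\<forall>l d. eval2 Q l d = \<beta> * eval2 Q' l d)"
    then obtain \<beta> where \<beta>: "\<beta> \<noteq> 0" "\<forall>l d. eval2 Q l d = \<beta> * eval2 Q' l d"
      by blast
    then show "\<exists>\<beta>. \<beta> \<noteq> 0 \<and> (\<forall>l d. eval2 Q l d = \<beta>\<^sup>2 * eval2 Q' l d)"
      by (intro exI[of _ "csqrt \<beta>"]) simp
  next
    assume "\<exists>\<beta>. \<beta> \<noteq> 0 \<and> (\<forall>l d. eval2 Q l d = \<beta>\<^sup>2 * eval2 Q' l d)"
    then obtain \<beta> where "\<beta> \<noteq> 0" "\<forall>l d. eval2 Q l d = \<beta>\<^sup>2 * eval2 Q' l d"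
      by blast
    then show "\<exists>\<beta>. \<beta> \<noteq> 0 \<and> (\<forall>l d. eval2 Q l d = \<beta> * eval2 Q' l d)"
      by (intro exI[of _ "\<beta>\<^sup>2"]) simp
  qed
  then show ?thesis
    by (simp add: flag_equiv_iff[OF conformal_zero(1) conformal_zero(1) conformal_zero(2) conformal_zero(2)] eq)
qed

text \<open>\<open>D1\<close> and \<open>T1\<close> are passed in because one pair has to serve for
  all flag datums.\<close>

lemma flag_datum_classification:
  assumes F: "flag_datum V F"
    and D1: "left_conformal dm dm D1" "D1 e = [:e:]"
    and T1: "right_conformal dm dm T1" "T1 e = [:e:]"
  obtains Q where "flag_equiv F (\<lambda>_. 0, \<lambda>_. 0, \<lambda>_. 0, \<lambda>_. 0, pmul Q e, 0)"
  | D T where "D \<in> {\<lambda>_. 0, D1}" "T \<in> {\<lambda>_. 0, T1}" "flag_equiv F (\<lambda>_. 0, D, \<lambda>_. 0, T, 0, 1)"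
proof -
  obtain D T Q P where DT: "F = (\<lambda>_. 0, D, \<lambda>_. 0, T, Q, P)"
    "left_conformal dm dm D" "right_conformal dm dm T"
    using F by (rule flag_datumE)
  have eqs:
    "eval2 P m (l + d) * ev1 crd (D e) l d = ev1 crd (D e) l (- l - m) * ev1 crd (D e) (l + m) d"
    "ev1 crd (T e) m (l + d) * ev1 crd (T e) l d = eval2 P l (- l - m) * ev1 crd (T e) (l + m) d"
    "ev1 crd Q m (l + d) * ev1 crd (T e) l d + eval2 P m (l + d) * ev1 crd Q l d
        = ev1 crd Q l (- l - m) * ev1 crd (D e) (l + m) d + eval2 P l (- l - m) * ev1 crd Q (l + m) d"
    "eval2 P m (l + d) * eval2 P l d = eval2 P l (- l - m) * eval2 P (l + m) d" for l m d
    using F unfolding DT(1) flag_datum_iff[OF DT(2,3)] by blast+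
  obtain c where P: "\<And>l d. eval2 P l d = c"
    using associative_product_const[of P, OF eqs(4)] by blast
  \<comment> \<open>Again \<open>k\<close> is \<lambda> + \<mu>, and \<open>P\<close> has already
    been replaced by its constant value.\<close>
  have "ev1 crd (D e) l (- k) * ev1 crd (D e) k d = c * ev1 crd (D e) l d" for l k d
    using eqs(1)[of "k - l" l d] by (simp add: P)
  then have "(\<forall>l d. ev1 crd (D e) l d = 0) \<or> (\<forall>l d. ev1 crd (D e) l d = c)"
    unfolding ev1_def by (rule middle_product_const)
  then obtain s where D: "\<And>l d. ev1 crd (D e) l d = s" and s: "s = 0 \<or> s = c"
    by blast
  have "(\<forall>l d. ev1 crd (T e) l d = 0) \<or> (\<forall>l d. ev1 crd (T e) l d = c)"
    using eqs(2) unfolding ev1_def P by (rule shift_product_const)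
  then obtain t where T: "\<And>l d. ev1 crd (T e) l d = t" and t: "t = 0 \<or> t = c"
    by blast
  show thesis
  proof (cases "c = 0")
    case True
    with s t have st: "s = 0" "t = 0" by auto
    \<comment> \<open>Here \<open>F\<close> is already of the first kind, so the identity change of
      generator suffices.\<close>
    have "flag_equiv F (\<lambda>_. 0, \<lambda>_. 0, \<lambda>_. 0, \<lambda>_. 0, pmul (map_poly crd Q) e, 0)"
      unfolding DT(1) flag_equiv_iff[OF DT(2) conformal_zero(1) DT(3) conformal_zero(2)]
      by (intro exI[of _ 0] exI[of _ 1]) (simp add: D T P True st flip: ev1_def)
    then show thesis by (rule that(1))
  next
    case False
    \<comment> \<open>The A-component of associativity on (x,x,x) is the cocycle equation; this
      \<open>p\<close> will be the coordinate polynomial of T0.\<close>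
    obtain p where p: "\<And>l d. ev1 crd Q l d = s * poly p (- l) + t * poly p (l + d) - c * poly p d"
    proof (rule flag_cocycle_coboundary[OF False s t])
      show "t * eval2 (map_poly crd Q) m (l + d) + c * eval2 (map_poly crd Q) l d
              = s * eval2 (map_poly crd Q) l (- l - m) + c * eval2 (map_poly crd Q) (l + m) d" for l m d
        using eqs(3)[of m l d] by (simp add: D T P mult.commute flip: ev1_def)
    qed (simp flip: ev1_def)
    define D' where "D' = (if s = 0 then \<lambda>_. 0 else D1)"
    define T' where "T' = (if t = 0 then \<lambda>_. 0 else T1)"
    have "left_conformal dm dm D'" "right_conformal dm dm T'"
      using D1(1) T1(1) conformal_zero by (simp_all add: D'_def T'_def)
    note iff = flag_equiv_iff[OF DT(2) this(1) DT(3) this(2)]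
    \<comment> \<open>Division by c sends s and t to 0 or 1, the values of the listed maps; the
      scale \<beta> = c below reverses it and normalises \<open>P\<close> to 1.\<close>
    have ev': "ev1 crd (D' e) l d = s / c" "ev1 crd (T' e) l d = t / c" for l d
      using False s t by (auto simp: D'_def T'_def D1(2) T1(2))
    have "flag_equiv F (\<lambda>_. 0, D', \<lambda>_. 0, T', 0, 1)"
      unfolding DT(1) iff using False
      by (intro exI[of _ p] exI[of _ c]) (simp add: D T P p ev' algebra_simps)
    then show thesis
      by (rule that(2)[rotated 2]) (simp_all add: D'_def T'_def)
  qed
qed

text \<open>Equivalent flag datums have the same class, so representatives from \<open>K\<close>
  reach every class.\<close>

lemma AH2_eq_image:
  assumes "\<forall>F\<in>K. flag_datum V F" "\<forall>F. flag_datum V F \<longrightarrow> (\<exists>F'\<in>K. flag_equiv F F')"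
  shows "AH2 V = (\<lambda>F. flag_rel V `` {F}) ` K"
proof (intro equalityI subsetI)
  fix X assume "X \<in> AH2 V"
  then obtain F where F: "flag_datum V F" "X = flag_rel V `` {F}"
    by (auto simp: AH2_def quotient_def)
  with assms obtain F' where F': "F' \<in> K" "flag_equiv F F'" by blast
  with assms F have "(F, F') \<in> flag_rel V"
    by (simp add: flag_rel_def)
  with equiv_flag_rel have "flag_rel V `` {F} = flag_rel V `` {F'}"
    by (rule equiv_class_eq)
  with F F' show "X \<in> (\<lambda>F. flag_rel V `` {F}) ` K"
    by blast
next
  fix X assume "X \<in> (\<lambda>F. flag_rel V `` {F}) ` K"
  with assms(1) show "X \<in> AH2 V"
    by (auto simp: AH2_def intro: quotientI)
qed

end

theorem proposition5p4:
  fixes dm :: "complex poly \<Rightarrow> 'a::ab_group_add \<Rightarrow> 'a"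
    and lp :: "'a \<Rightarrow> 'a \<Rightarrow> 'a poly"
    and e :: 'a
    and V :: "'a set"
  assumes "assoc_conformal_algebra dm lp"
    and "\<not> module.dependent dm {e}"
    and "module.span dm {e} = UNIV"
    and "lp e e = 0"
    and "V = {dm [:c:] e | c. True}"
  shows "\<exists>D1 T1.
    left_conformal dm dm D1 \<and> D1 e = [:e:] \<and>
    right_conformal dm dm T1 \<and> T1 e = [:e:] \<and>
    (let pmul = assoc_conformal_algebra.pmul dm;
         flag = assoc_conformal_algebra.flag_datum dm lp V;
         equ = assoc_conformal_algebra.flag_equiv dm lp;
         kind1 = (\<lambda>Q :: complex poly poly. ((\<lambda>_. 0), (\<lambda>_. 0), (\<lambda>_. 0), (\<lambda>_. 0), pmul Q e, 0));
         kinds = range kind1 \<union>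
           {((\<lambda>_. 0), (\<lambda>_. 0), (\<lambda>_. 0), (\<lambda>_. 0), 0, 1),
            ((\<lambda>_. 0), (\<lambda>_. 0), (\<lambda>_. 0), T1, 0, 1),
            ((\<lambda>_. 0), D1, (\<lambda>_. 0), (\<lambda>_. 0), 0, 1),
            ((\<lambda>_. 0), D1, (\<lambda>_. 0), T1, 0, 1)}
     in (\<forall>F\<in>kinds. flag F) \<and>
        (\<forall>F. flag F \<longrightarrow> (\<exists>F'\<in>kinds. equ F F')) \<and>
        assoc_conformal_algebra.AH2 dm lp V
          = (\<lambda>F. assoc_conformal_algebra.flag_rel dm lp V `` {F}) ` kinds \<and>
        (\<forall>Q Q'. equ (kind1 Q) (kind1 Q') \<longleftrightarrow> (\<exists>\<beta>. \<beta> \<noteq> 0 \<and> Q = smult [:\<beta>:] Q')))"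
proof -
  interpret assoc_conformal_algebra dm lp by fact
  \<comment> \<open>Independence of \<open>e\<close> makes coordinates unique and its span makes
    them exist, so \<open>crd\<close> below inverts the map sending p to p(\<partial>)e.\<close>
  have inj: "p = q" if "dm p e = dm q e" for p q
  proof -
    have "(\<Sum>v\<in>{e}. dm (p - q) v) = 0"
      using that by (simp add: scale_left_diff_distrib)
    then have "p - q = 0"
      using independentD[OF assms(2), of "{e}" "\<lambda>_. p - q" e] by simp
    then show ?thesis by simp
  qed
  have "\<exists>p. dm p e = u" for u
    using assms(3) by (simp add: span_singleton surj_def) metis
  then obtain crd where crd: "\<And>u. dm (crd u) e = u"
    by metis
  interpret null_rank_one dm lp crd e V
  proof unfold_locales
    show "crd (u + v) = crd u + crd v" for u v
      by (rule inj) (simp add: crd scale_left_distrib)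
    show "crd (dm p u) = p * crd u" for p u
      by (rule inj) (simp add: crd flip: scale_scale)
    show "crd u = crd v \<longleftrightarrow> u = v" for u v
      using crd by metis
    show "crd e = 1"
      by (rule inj) (simp add: crd)
  qed (fact assms)+
  obtain D1 T1 where D1: "left_conformal dm dm D1" "D1 e = [:e:]"
    and T1: "right_conformal dm dm T1" "T1 e = [:e:]"
    using ex_left_conformal ex_right_conformal by blast
  define kind1 :: "complex poly poly \<Rightarrow> 'a flag"
    where "kind1 = (\<lambda>Q. (\<lambda>_. 0, \<lambda>_. 0, \<lambda>_. 0, \<lambda>_. 0, pmul Q e, 0))"
  define kinds where "kinds = range kind1 \<union>
    {(\<lambda>_. 0, \<lambda>_. 0, \<lambda>_. 0, \<lambda>_. 0, 0, 1), (\<lambda>_. 0, \<lambda>_. 0, \<lambda>_. 0, T1, 0, 1),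
     (\<lambda>_. 0, D1, \<lambda>_. 0, \<lambda>_. 0, 0, 1), (\<lambda>_. 0, D1, \<lambda>_. 0, T1, 0, 1)}"
  have ev: "ev1 crd (D1 e) = (\<lambda>_ _. 1)" "ev1 crd (T1 e) = (\<lambda>_ _. 1)" "ev1 crd 0 = (\<lambda>_ _. 0)"
    by (intro ext; simp add: D1(2) T1(2))+
  have 1: "\<forall>F\<in>kinds. flag_datum V F"
    unfolding kinds_def kind1_def
    using flag_datum_kind1 flag_datum_kinds2_5[OF D1(1) ev(1) _ T1(1) ev(2)]
      flag_datum_kinds2_5[OF D1(1) ev(1) _ conformal_zero(2) ev(3)]
      flag_datum_kinds2_5[OF conformal_zero(1) ev(3) _ T1(1) ev(2)]
      flag_datum_kinds2_5[OF conformal_zero(1) ev(3) _ conformal_zero(2) ev(3)] by auto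
  have 2: "\<exists>F'\<in>kinds. flag_equiv F F'" if "flag_datum V F" for F
    using flag_datum_classification[OF that D1 T1]
    by cases (auto simp: kinds_def kind1_def)
  have 3: "AH2 V = (\<lambda>F. flag_rel V `` {F}) ` kinds"
    using 1 2 by (intro AH2_eq_image) blast+
  have 4: "flag_equiv (kind1 Q) (kind1 Q') \<longleftrightarrow> (\<exists>\<beta>. \<beta> \<noteq> 0 \<and> Q = smult [:\<beta>:] Q')" for Q Q'
    unfolding kind1_def by (rule flag_equiv_kind1_iff)
  show ?thesis
    unfolding Let_def kind1_def[symmetric] kinds_def[symmetric]
    by (intro exI[of _ D1] exI[of _ T1] conjI D1 T1 allI impI) (use 1 2 3 4 in \<open>simp_all add: kinds_def kind1_def\<close>)
qed

end
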